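(* Let $k$ be a field of characteristic $\ne 2$, $\bar k$ an algebraic closure, $d\in k\setminus\{0,1\}$, and fix square roots $\sqrt{-1},\sqrt d,\sqrt{1-d},\sqrt{d-1},\sqrt{d/(d-1)}\in\bar k$. Put $$\bar d_1 = \left(\frac{1+\sqrt d}{1-\sqrt d}\right)^2,\quad \bar d_2 = \left(\frac{1+\sqrt{1-d}}{1-\sqrt{1-d}}\right)^2,\quad \bar d_3 = \left(\frac{1+\sqrt{d/(d-1)}}{1-\sqrt{d/(d-1)}}\right)^2.$$ Then there exist $2$-isogenies (over $\bar k$) from $E_d$ to $E_{\bar d_1^{\pm1}}$, $E_{\bar d_2^{\pm1}}$ and $E_{\bar d_3^{\pm1}}$, given respectively by: (a) $\epsilon_{\bar d_1,\pm}: E_d\to E_{\bar d_1^{\pm1}}$, $(x,y)\mapsto\left(\frac{\sqrt{-1}(1\mp\sqrt d)}{d-1}\cdot\frac{1-y^2}{xy}, \frac{1\mp\sqrt d\,x^2}{1\pm\sqrt d\,x^2}\right)$; (b) $\epsilon_{\bar d_2,\pm}: E_d\to E_{\bar d_2^{\pm1}}$, $(x,y)\mapsto\left((1\mp\sqrt{1-d})xy, \frac{1-(1\mp\sqrt{1-d})x^2}{1-(1\pm\sqrt{1-d})x^2}\right)$; (c) $\epsilon_{\bar d_3,\pm}: E_d\to E_{\bar d_3^{\pm1}}$, $(x,y)\mapsto\left(\frac{\sqrt{d-1}\mp\sqrt d}{1-d}\cdot\frac{x}{y}, \frac{1-\big(d\pm(1-d)\sqrt{\frac{d}{d-1}}\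big)x^2}{1-\big(d\mp(1-d)\sqrt{\frac{d}{d-1}}\big)x^2}\right)$.
   Context: For $c \in \bar k\setminus\{0,1\}$, $E_c$ denotes the Edwards elliptic curve, the desingularization of the projective closure of $x^2+y^2 = 1+cx^2y^2$. In each item the upper signs give the isogeny to the curve with parameter $\bar d_i$ and the lower signs the isogeny to the curve with parameter $\bar d_i^{-1}$.
   Formalization: In (c) the coefficient of x/y is √(d-1)∓√d, without the factor 1/(1-d), and the roots are chosen so that √(d/(d-1)) = √d/√(d-1); as displayed, the map in (c) does not land on the target curve (for example d = 5). *)

theory Defs
  imports "HOL-Algebra.Algebraic_Closure_Type"
begin

section \<open>Function fields and their nonsingular curves\<close>

text \<open>
  A function field over \<open>K\<close> (the type \<open>'a\<close>, algebraically closed in all applications) is a field in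
  the sense of HOL-Algebra together with the embedding of the constants.
\<close>

record ('f, 'a) function_field = "'f ring" + const :: "'a \<Rightarrow> 'f"

text \<open>
  The desingularization (normalization) of an irreducible projective curve \<open>X\<close> over an algebraically
  closed field \<open>K\<close> is the abstract nonsingular curve of the function field \<open>F = K(X)\<close>: its points are
  the places of \<open>F/K\<close>, that is the valuation rings \<open>P\<close> with \<open>K \<subset> P \<subset> F\<close> (all of them are
  discrete), which are the local rings of the points; a nonempty set is open iff its complement is
  finite; and the functions regular on an open \<open>U\<close> are the elements of \<open>\<Inter>P\<in>U. P\<close>
  (Hartshorne, Algebraic Geometry, I.6).
\<close>

definition places :: "('f, 'a) function_field \<Rightarrow> 'f set set" where
  "places F = {P. subring P F \<and> range (const F) \<subseteq> P \<and> P \<noteq> carrier F \<and>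
     (\<forall>z\<in>carrier F - {\<zero>\<^bsub>F\<^esub>}. z \<in> P \<or> inv\<^bsub>F\<^esub> z \<in> P)}"

definition place_ideal :: "('f, 'a) function_field \<Rightarrow> 'f set \<Rightarrow> 'f set" where
  "place_ideal F P = {z \<in> P. z = \<zero>\<^bsub>F\<^esub> \<or> inv\<^bsub>F\<^esub> z \<notin> P}"

text \<open>\<open>f\<close> is regular at the point \<open>P\<close> and \<open>f(P) = a\<close>, by means of \<open>P/m\<^sub>P = K\<close>.\<close>

definition has_value :: "('f, 'a) function_field \<Rightarrow> 'f set \<Rightarrow> 'f \<Rightarrow> 'a \<Rightarrow> bool" where
  "has_value F P f a \<longleftrightarrow> f \<in> carrier F \<and> f \<ominus>\<^bsub>F\<^esub> const F a \<in> place_ideal F P"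

definition curve_open :: "('f, 'a) function_field \<Rightarrow> 'f set set \<Rightarrow> bool" where
  "curve_open F U \<longleftrightarrow> U \<subseteq> places F \<and> (U = {} \<or> finite (places F - U))"

definition regular_on :: "('f, 'a) function_field \<Rightarrow> 'f set set \<Rightarrow> 'f set" where
  "regular_on F U = {f \<in> carrier F. \<forall>P\<in>U. f \<in> P}"

text \<open>
  Morphisms: continuous maps that pull back regular functions (as functions with values in \<open>K\<close>) to
  regular functions.
\<close>

definition curve_morphism ::
  "('f, 'a) function_field \<Rightarrow> ('g, 'a) function_field \<Rightarrow> ('f set \<Rightarrow> 'g set) \<Rightarrow> bool" where
  "curve_morphism F G \<phi> \<longleftrightarrow> \<phi> ` places F \<subseteq> places G \<and>
     (\<forall>V. curve_open G V \<longrightarrow>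
        curve_open F {P \<in> places F. \<phi> P \<in> V} \<and>
        (\<forall>f\<in>regular_on G V. \<exists>g\<in>regular_on F {P \<in> places F. \<phi> P \<in> V}.
           \<forall>P\<in>places F. \<phi> P \<in> V \<longrightarrow> (\<forall>a. has_value F P g a \<longleftrightarrow> has_value G (\<phi> P) f a)))"

text \<open>\<open>\<theta>\<close> is the embedding \<open>f \<mapsto> f \<circ> \<phi>\<close> of function fields; it exists only for nonconstant \<open>\<phi>\<close>.\<close>

definition comorphism ::
  "('f, 'a) function_field \<Rightarrow> ('g, 'a) function_field \<Rightarrow> ('f set \<Rightarrow> 'g set) \<Rightarrow> ('g \<Rightarrow> 'f) \<Rightarrow> bool" where
  "comorphism F G \<phi> \<theta> \<longleftrightarrow> \<theta> \<in> ring_hom G F \<and> (\<forall>a. \<theta> (const G a) = const F a) \<and>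
     (\<forall>P\<in>places F. \<forall>f\<in>\<phi> P. \<theta> f \<in> P \<and> (\<forall>a. has_value F P (\<theta> f) a \<longleftrightarrow> has_value G (\<phi> P) f a))"

definition has_degree ::
  "('f, 'a) function_field \<Rightarrow> ('g, 'a) function_field \<Rightarrow> ('f set \<Rightarrow> 'g set) \<Rightarrow> nat \<Rightarrow> bool" where
  "has_degree F G \<phi> n \<longleftrightarrow>
     (\<exists>\<theta>. comorphism F G \<phi> \<theta> \<and> ring.dimension F n (\<theta> ` carrier G) (carrier F))"

text \<open>
  Isogenies of elliptic curves \<open>(F, O) \<rightarrow> (G, O')\<close>: morphisms of curves mapping the neutral element
  to the neutral element, here nonconstant since they have a degree.
\<close>

definition isogeny_of_degree ::
  "nat \<Rightarrow> ('f, 'a) function_field \<Rightarrow> 'f set \<Rightarrow> ('g, 'a) function_field \<Rightarrow> 'g set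
     \<Rightarrow> ('f set \<Rightarrow> 'g set) \<Rightarrow> bool" where
  "isogeny_of_degree n F O1 G O2 \<phi> \<longleftrightarrow>
     curve_morphism F G \<phi> \<and> \<phi> O1 = O2 \<and> has_degree F G \<phi> n"


section \<open>The function field of a plane curve\<close>

text \<open>
  Polynomials in \<open>K[x,y]\<close> are elements of \<open>K[x][y]\<close>, the type \<open>'a poly poly\<close>.  For an irreducible
  \<open>p\<close>, the function field of the curve \<open>p = 0\<close> (and of its projective closure) is the fraction field
  of \<open>K[x,y]/(p)\<close>, realized as the residue field of the localization of \<open>K[x,y]\<close> at the prime
  ideal \<open>(p)\<close>.
\<close>

type_synonym 'a ratfun = "'a poly poly fract"

definition var_x :: "'a::field poly poly" where "var_x = [:[:0, 1:]:]"

definition var_y :: "'a::field poly poly" where "var_y = [:0, 1:]"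

definition plane_local_ring :: "'a::field poly poly \<Rightarrow> 'a ratfun ring" where
  "plane_local_ring p =
     \<lparr>carrier = {Fract g h | g h. \<not> p dvd h}, monoid.mult = (*), one = 1, zero = 0, add = (+)\<rparr>"

definition plane_local_ideal :: "'a::field poly poly \<Rightarrow> 'a ratfun set" where
  "plane_local_ideal p = {Fract g h | g h. p dvd g \<and> \<not> p dvd h}"

definition restrict_to_curve :: "'a::field poly poly \<Rightarrow> 'a ratfun \<Rightarrow> 'a ratfun set" where
  "restrict_to_curve p r = plane_local_ideal p +>\<^bsub>plane_local_ring p\<^esub> r"

definition plane_function_field :: "'a::field poly poly \<Rightarrow> ('a ratfun set, 'a) function_field" where
  "plane_function_field p =
     ring.extend (plane_local_ring p Quot plane_local_ideal p)
       \<lparr>const = (\<lambda>a. restrict_to_curve p (Fract [:[:a:]:] 1))\<rparr>"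


section \<open>Edwards curves\<close>

text \<open>
  \<open>x\<^sup>2 + y\<^sup>2 - 1 - c x\<^sup>2 y\<^sup>2\<close>, which is irreducible for \<open>c \<noteq> 0, 1\<close> in characteristic other than 2;
  the elliptic curve \<open>E\<^sub>c\<close> is the set of places of \<open>edwards_field c\<close>.
\<close>

definition edwards_poly :: "'a::field \<Rightarrow> 'a poly poly" where
  "edwards_poly c = var_x\<^sup>2 + var_y\<^sup>2 - 1 - [:[:c:]:] * var_x\<^sup>2 * var_y\<^sup>2"

definition edwards_field :: "'a::field \<Rightarrow> ('a ratfun set, 'a) function_field" where
  "edwards_field c = plane_function_field (edwards_poly c)"

text \<open>The point \<open>P\<close> of \<open>E\<^sub>c\<close> lies over the affine point \<open>(a, b)\<close>.\<close>

definition edwards_coords :: "'a::field \<Rightarrow> 'a ratfun set set \<Rightarrow> 'a \<Rightarrow> 'a \<Rightarrow> bool" where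
  "edwards_coords c P a b \<longleftrightarrow>
     has_value (edwards_field c) P (restrict_to_curve (edwards_poly c) (Fract var_x 1)) a \<and>
     has_value (edwards_field c) P (restrict_to_curve (edwards_poly c) (Fract var_y 1)) b"

text \<open>The neutral element \<open>(0, 1)\<close> of the Edwards group law; \<open>(0, 1)\<close> is a smooth point.\<close>

definition edwards_origin :: "'a::field \<Rightarrow> 'a ratfun set set" where
  "edwards_origin c = (THE P. P \<in> places (edwards_field c) \<and> edwards_coords c P 0 1)"

definition edwards_isogeny ::
  "nat \<Rightarrow> 'a::field \<Rightarrow> 'a \<Rightarrow> ('a ratfun set set \<Rightarrow> 'a ratfun set set) \<Rightarrow> bool" where
  "edwards_isogeny n c c' \<phi> \<longleftrightarrow>
     isogeny_of_degree n (edwards_field c) (edwards_origin c)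
       (edwards_field c') (edwards_origin c') \<phi>"

text \<open>
  \<open>\<phi>\<close> is given on the affine curve by \<open>(x, y) \<mapsto> (u\<^sub>1 / u\<^sub>2, v\<^sub>1 / v\<^sub>2)\<close>, wherever
  the denominators do not vanish.
\<close>

definition edwards_given_by ::
  "'a::field \<Rightarrow> 'a \<Rightarrow> ('a ratfun set set \<Rightarrow> 'a ratfun set set) \<Rightarrow>
     ('a \<Rightarrow> 'a \<Rightarrow> ('a \<times> 'a) \<times> ('a \<times> 'a)) \<Rightarrow> bool" where
  "edwards_given_by c c' \<phi> h \<longleftrightarrow>
     (\<forall>P\<in>places (edwards_field c). \<forall>x y u1 u2 v1 v2.
        edwards_coords c P x y \<and> h x y = ((u1, u2), (v1, v2)) \<and> u2 \<noteq> 0 \<and> v2 \<noteq> 0 \<longrightarrow>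
        edwards_coords c' (\<phi> P) (u1 / u2) (v1 / v2))"

text \<open>
  The coefficient \<open>l\<close> of \<open>x / y\<close> in the isogeny to \<open>E\<^sub>D\<close>, \<open>D = ((1 + s) / (1 - s))\<^sup>2\<close> with
  \<open>s\<^sup>2 = d / (d - 1)\<close>, is determined up to sign by the equation of the target curve.  If
  \<open>s = \<surd>d / \<surd>(d - 1)\<close> it is \<open>\<plusminus> (\<surd>(d - 1) - \<surd>d)\<close>, with no further factor \<open>1 / (1 - d)\<close>; for
  the other sign of \<open>s\<close> it is \<open>\<plusminus> (\<surd>(d - 1) + \<surd>d)\<close>.  Replacing \<open>s\<close> by \<open>-s\<close> gives the
  isogeny to the curve with parameter \<open>1 / D\<close>.
\<close>

lemma edwards_third_scaling:
  fixes d s x y l v D :: "'a::field"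
  assumes two: "(2::'a) \<noteq> 0" and d: "d \<noteq> 0" "d \<noteq> 1" and s: "s\<^sup>2 = d / (d - 1)"
    and D: "D = ((1 + s) / (1 - s))\<^sup>2"
    and xy: "x\<^sup>2 + y\<^sup>2 = 1 + d * x\<^sup>2 * y\<^sup>2" "x \<noteq> 0" "y \<noteq> 0" "1 - d * x\<^sup>2 \<noteq> 0"
    and n: "1 - (d - (1 - d) * s) * x\<^sup>2 \<noteq> 0"
    and v: "v = (1 - (d + (1 - d) * s) * x\<^sup>2) / (1 - (d - (1 - d) * s) * x\<^sup>2)"
  shows "(l * (x / y))\<^sup>2 + v\<^sup>2 = 1 + D * (l * (x / y))\<^sup>2 * v\<^sup>2 \<longleftrightarrow> l\<^sup>2 = (d - 1) * (1 - s)\<^sup>2"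
proof -
  define w where "w = 1 - (d - (1 - d) * s) * x\<^sup>2"
  define m where "m = 1 - (d + (1 - d) * s) * x\<^sup>2"
  have s2: "s\<^sup>2 * (d - 1) = d" using s d by simp
  have s1: "1 - s \<noteq> 0"
  proof
    assume "1 - s = 0" then have "s = 1" by simp
    with s2 show False by simp
  qed
  have s0: "s \<noteq> 0" using s2 d by auto
  have v': "v * w = m" using n v by (simp add: w_def m_def)
  have D': "D * (1 - s)\<^sup>2 = (1 + s)\<^sup>2" using s1 D by (simp add: power_divide)
  have y2: "y\<^sup>2 * (1 - d * x\<^sup>2) = 1 - x\<^sup>2" using xy(1) by (simp add: algebra_simps)
  have w1: "(1 - s) * w = 1 - s + s * x\<^sup>2"
  proof -
    have "(1 - s) * w = 1 - s + s * x\<^sup>2 + x\<^sup>2 * (s\<^sup>2 * (d - 1) - d)"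
      unfolding w_def by (simp add: algebra_simps power2_eq_square)
    then show ?thesis using s2 by simp
  qed
  have m1: "(1 + s) * m = 1 + s - s * x\<^sup>2"
  proof -
    have "(1 + s) * m = 1 + s - s * x\<^sup>2 + x\<^sup>2 * (s\<^sup>2 * (d - 1) - d)"
      unfolding m_def by (simp add: algebra_simps power2_eq_square)
    then show ?thesis using s2 by simp
  qed
  have A: "w\<^sup>2 - m\<^sup>2 = 4 * (1 - d) * s * x\<^sup>2 * (1 - d * x\<^sup>2)"
    unfolding w_def m_def by (simp add: algebra_simps power2_eq_square)
  have B: "(1 - s)\<^sup>2 * w\<^sup>2 - (1 + s)\<^sup>2 * m\<^sup>2 = - 4 * s * (1 - x\<^sup>2)"
    unfolding power_mult_distrib[symmetric] w1 m1 by (simp add: algebra_simps power2_eq_square)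
  define u where "u = l * (x / y)"
  have u: "u * y = l * x" using xy by (simp add: u_def)
  have "u\<^sup>2 + v\<^sup>2 = 1 + D * u\<^sup>2 * v\<^sup>2 \<longleftrightarrow> u\<^sup>2 * (1 - D * v\<^sup>2) = 1 - v\<^sup>2"
    by (auto simp: algebra_simps)
  also have "\<dots> \<longleftrightarrow> (1-s)\<^sup>2 * w\<^sup>2 * y\<^sup>2 * (u\<^sup>2 * (1 - D * v\<^sup>2)) = (1-s)\<^sup>2 * w\<^sup>2 * y\<^sup>2 * (1 - v\<^sup>2)"
    using s1 n xy by (simp add: w_def)
  also have "(1-s)\<^sup>2 * w\<^sup>2 * y\<^sup>2 * (u\<^sup>2 * (1 - D * v\<^sup>2)) = l\<^sup>2 * x\<^sup>2 * ((1-s)\<^sup>2 * w\<^sup>2 - (1+s)\<^sup>2 * m\<^sup>2)"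
  proof -
    have "(1-s)\<^sup>2 * w\<^sup>2 * y\<^sup>2 * (u\<^sup>2 * (1 - D * v\<^sup>2))
        = (u * y)\<^sup>2 * ((1-s)\<^sup>2 * w\<^sup>2 - (D * (1-s)\<^sup>2) * (v * w)\<^sup>2)"
      by (simp add: algebra_simps power_mult_distrib)
    then show ?thesis unfolding v' D' u by (simp add: power_mult_distrib)
  qed
  also have "\<dots> = (4 * s * x\<^sup>2 * (1 - d * x\<^sup>2) * y\<^sup>2) * (- (l\<^sup>2))"
    unfolding B using y2 by (simp add: mult_ac flip: y2)
  also have "(1-s)\<^sup>2 * w\<^sup>2 * y\<^sup>2 * (1 - v\<^sup>2) = (1-s)\<^sup>2 * y\<^sup>2 * (w\<^sup>2 - m\<^sup>2)"
    unfolding v'[symmetric] by (simp add: algebra_simps power_mult_distrib)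
  also have "\<dots> = (4 * s * x\<^sup>2 * (1 - d * x\<^sup>2) * y\<^sup>2) * ((1 - d) * (1 - s)\<^sup>2)"
    unfolding A by (simp only: mult_ac)
  also have "(4 * s * x\<^sup>2 * (1 - d * x\<^sup>2) * y\<^sup>2) * (- (l\<^sup>2)) = \<dots> \<longleftrightarrow> - (l\<^sup>2) = (1 - d) * (1 - s)\<^sup>2"
  proof -
    have "(4::'a) = 2 * 2" by simp
    then have "(4::'a) \<noteq> 0" using two by (metis mult_eq_0_iff)
    then have "4 * s * x\<^sup>2 * (1 - d * x\<^sup>2) * y\<^sup>2 \<noteq> 0" using s0 xy by simp
    then show ?thesis by (metis mult_cancel_left)
  qed
  also have "\<dots> \<longleftrightarrow> l\<^sup>2 = (d - 1) * (1 - s)\<^sup>2"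
    by (smt (verit) minus_diff_eq minus_equation_iff mult_minus_left)
  finally show ?thesis unfolding u_def .
qed

end

theory Submission
  imports Defs "HOL-Computational_Algebra.Formal_Laurent_Series"
begin

text \<open>
  A generic point \<open>(u, v)\<close> of \<open>E\<^sub>c\<close> with coordinates in a field extending \<open>K\<close> identifies the function
  field of \<open>E\<^sub>c\<close> with the subfield \<open>K(u, v)\<close>, and its places with valuation rings of \<open>K(u, v)\<close>.  For the
  source take the Laurent series \<open>x = X\<close> and \<open>y = \<surd>((1 - X\<^sup>2) / (1 - d X\<^sup>2))\<close> in \<open>K((X))\<close>; the
  valuation of \<open>K((X))\<close> then gives the origin.  In all six cases the formulas have the shape
  \<open>u = x y l (1 - a x\<^sup>2) / (1 - b x\<^sup>2)\<close> and \<open>v = (1 - \<alpha> x\<^sup>2) / (1 - \<beta> x\<^sup>2)\<close> with \<open>\<alpha> \<noteq> \<beta>\<close>, and satisfy the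
  equation of the target curve, whose function field thus becomes \<open>M = K(u, v) = K(x\<^sup>2, x y)\<close> inside
  \<open>L = K(x, y)\<close>.  The involution \<open>(x, y) \<mapsto> (-x, -y)\<close> of \<open>L\<close> fixes \<open>M\<close>, and \<open>L = M + M x\<close>, so the degree
  is 2.  The isogeny is \<open>P \<mapsto> P \<inter> M\<close>; it has finite fibres because two valuation rings of \<open>L\<close> with
  the same trace on \<open>M\<close> are conjugate under the involution.
\<close>

section \<open>Subfields and valuation rings\<close>

text \<open>The map from (x, y) to (-x, -y) is translation by the point (0, -1) of order 2, so all
  six isogenies have the same kernel, and their targets are Edwards models of one quotient curve.
  The formulas come from solving the target equation: u^2 = (1 - v^2) / (1 - D v^2), where v = m / w
  is a fractional linear function of x^2 with value 1 at the origin. With D = ((1 + s) / (1 - s))^2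
  the right side is (1 - s)^2 (w^2 - m^2) / ((1 - s)^2 w^2 - (1 + s)^2 m^2), and in each case the
  curve equation makes this a square in M.

  Three obstacles shape the proof. Places are arbitrary valuation rings, not known to be discrete,
  so their behaviour over M is derived from quadratic equations alone. The neutral element is a
  definite description, so sending origin to origin needs a unique place over (0, 1) on both curves;
  this is smoothness, in the form that x is a uniformizer there. Finally, the Edwards polynomial
  must generate a prime ideal; this is obtained by identifying that ideal with the kernel of
  evaluation at the generic point.\<close>

locale constant_embedding =
  fixes emb :: "'a::field \<Rightarrow> 'b::field"
  assumes emb_1 [simp]: "emb 1 = 1"
    and emb_add: "emb (a + b) = emb a + emb b"
    and emb_mult: "emb (a * b) = emb a * emb b"
begin

lemma emb_0 [simp]: "emb 0 = 0"
proof -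
  have "emb 0 + emb 0 = emb 0 + 0" using emb_add[of 0 0] by simp
  then show ?thesis by (rule add_left_imp_eq)
qed

lemma emb_minus: "emb (- a) = - emb a"
  using emb_add[of a "- a"] by (simp add: eq_neg_iff_add_eq_0 add.commute)

lemma emb_diff: "emb (a - b) = emb a - emb b"
  using emb_add[of a "- b"] by (simp add: emb_minus)

lemma emb_power: "emb (a ^ n) = emb a ^ n"
  by (induction n) (simp_all add: emb_mult)

lemma emb_eq_0_iff [simp]: "emb a = 0 \<longleftrightarrow> a = 0"
proof
  assume a: "emb a = 0"
  have "emb (a * inverse a) = 0" unfolding emb_mult a by simp
  then show "a = 0" by (cases "a = 0") auto
qed simp

lemma emb_eq_iff [simp]: "emb a = emb b \<longleftrightarrow> a = b"
  using emb_eq_0_iff[of "a - b"] by (simp add: emb_diff del: emb_eq_0_iff)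

lemma emb_inverse: "emb (inverse a) = inverse (emb a)"
proof (cases "a = 0")
  case False
  then have "emb (inverse a) * emb a = 1" by (simp flip: emb_mult)
  then show ?thesis using inverse_unique by (metis inverse_inverse_eq)
qed simp

lemma emb_divide: "emb (a / b) = emb a / emb b"
  by (simp add: field_class.field_divide_inverse emb_mult emb_inverse)

lemma emb_2: "emb 2 = 2"
  using emb_add[of 1 1] by simp

lemmas emb_simps = emb_add emb_mult emb_minus emb_diff emb_power emb_inverse emb_divide emb_2

definition const_subfield :: "'b set \<Rightarrow> bool" where
  "const_subfield M \<longleftrightarrow> range emb \<subseteq> M \<and> (\<forall>z\<in>M. \<forall>w\<in>M. z + w \<in> M \<and> z * w \<in> M) \<and>
     (\<forall>z\<in>M. inverse z \<in> M)"

lemma const_subfieldI: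
  assumes "\<And>a. emb a \<in> M" "\<And>z w. z \<in> M \<Longrightarrow> w \<in> M \<Longrightarrow> z + w \<in> M"
    "\<And>z w. z \<in> M \<Longrightarrow> w \<in> M \<Longrightarrow> z * w \<in> M" "\<And>z. z \<in> M \<Longrightarrow> z \<noteq> 0 \<Longrightarrow> inverse z \<in> M"
  shows "const_subfield M"
  unfolding const_subfield_def using assms by (metis image_subset_iff inverse_zero)

context
  fixes M assumes M: "const_subfield M"
begin

lemma sf_const: "emb a \<in> M" and sf_add: "z \<in> M \<Longrightarrow> w \<in> M \<Longrightarrow> z + w \<in> M"
  and sf_mult: "z \<in> M \<Longrightarrow> w \<in> M \<Longrightarrow> z * w \<in> M" and sf_inverse: "z \<in> M \<Longrightarrow> inverse z \<in> M"
  using M by (auto simp: const_subfield_def)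

lemma sf_0: "0 \<in> M" and sf_1: "1 \<in> M"
  using sf_const[of 0] sf_const[of 1] by auto

lemma sf_minus: "z \<in> M \<Longrightarrow> - z \<in> M"
  using sf_mult[OF sf_const[of "- 1"]] by (simp add: emb_minus)

lemma sf_diff: "z \<in> M \<Longrightarrow> w \<in> M \<Longrightarrow> z - w \<in> M"
  using sf_add[OF _ sf_minus] by fastforce

lemma sf_divide: "z \<in> M \<Longrightarrow> w \<in> M \<Longrightarrow> z / w \<in> M"
  by (simp add: field_class.field_divide_inverse sf_mult sf_inverse)

lemma sf_power: "z \<in> M \<Longrightarrow> z ^ n \<in> M"
  by (induction n) (auto simp: sf_1 sf_mult)

lemma sf_inverse_iff: "inverse z \<in> M \<longleftrightarrow> z \<in> M"
  using sf_inverse by (metis inverse_inverse_eq)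

end

lemmas sf_intros = sf_const sf_add sf_mult sf_inverse sf_0 sf_1 sf_minus sf_diff sf_divide sf_power

definition generated :: "'b set \<Rightarrow> 'b set" where
  "generated S = \<Inter>{M. const_subfield M \<and> S \<subseteq> M}"

lemma const_subfield_generated: "const_subfield (generated S)"
  by (rule const_subfieldI) (auto simp: generated_def intro: sf_intros)

lemma generated_incl: "z \<in> S \<Longrightarrow> z \<in> generated S"
  by (auto simp: generated_def)

lemma generated_least: "const_subfield M \<Longrightarrow> S \<subseteq> M \<Longrightarrow> generated S \<subseteq> M"
  by (auto simp: generated_def)

text \<open>Closure under negation follows, since \<open>emb (- 1)\<close> lies in \<open>V\<close>.
  In the last clause z = 0 causes no exception, because 0 is a constant.\<close>

definition val_ring :: "'b set \<Rightarrow> 'b set \<Rightarrow> bool" where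
  "val_ring L V \<longleftrightarrow> V \<subseteq> L \<and> V \<noteq> L \<and> range emb \<subseteq> V \<and> (\<forall>z\<in>V. \<forall>w\<in>V. z + w \<in> V \<and> z * w \<in> V) \<and>
     (\<forall>z\<in>L. z \<in> V \<or> inverse z \<in> V)"

definition max_ideal :: "'b set \<Rightarrow> 'b set" where
  "max_ideal V = {z \<in> V. z = 0 \<or> inverse z \<notin> V}"

definition val_at :: "'b set \<Rightarrow> 'b \<Rightarrow> 'a \<Rightarrow> bool" where
  "val_at V z a \<longleftrightarrow> z - emb a \<in> max_ideal V"

lemma mi_sub: "z \<in> max_ideal V \<Longrightarrow> z \<in> V"
  by (simp add: max_ideal_def)

context
  fixes L V assumes L: "const_subfield L" and V: "val_ring L V"
begin

lemma vr_const: "emb a \<in> V" and vr_add: "z \<in> V \<Longrightarrow> w \<in> V \<Longrightarrow> z + w \<in> V"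
  and vr_mult: "z \<in> V \<Longrightarrow> w \<in> V \<Longrightarrow> z * w \<in> V" and vr_sub: "z \<in> V \<Longrightarrow> z \<in> L"
  and vr_total: "z \<in> L \<Longrightarrow> z \<notin> V \<Longrightarrow> inverse z \<in> V"
  using V by (auto simp: val_ring_def)

lemma vr_0: "0 \<in> V" and vr_1: "1 \<in> V"
  using vr_const[of 0] vr_const[of 1] by auto

lemma vr_minus: "z \<in> V \<Longrightarrow> - z \<in> V"
  using vr_mult[OF vr_const[of "- 1"]] by (simp add: emb_minus)

lemma vr_diff: "z \<in> V \<Longrightarrow> w \<in> V \<Longrightarrow> z - w \<in> V"
  using vr_add[OF _ vr_minus] by fastforce

lemma vr_power: "z \<in> V \<Longrightarrow> z ^ n \<in> V"
  by (induction n) (auto simp: vr_1 vr_mult)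

lemma mi_0: "0 \<in> max_ideal V"
  by (simp add: max_ideal_def vr_0)

lemma mi_one: "1 \<notin> max_ideal V"
  by (simp add: max_ideal_def vr_1)

lemma mi_mult: "r \<in> V \<Longrightarrow> z \<in> max_ideal V \<Longrightarrow> r * z \<in> max_ideal V"
proof -
  assume r: "r \<in> V" and z: "z \<in> max_ideal V"
  have "inverse z \<in> V" if "inverse (r * z) \<in> V" "r * z \<noteq> 0"
    using vr_mult[OF r that(1)] that(2) by (simp add: field_simps)
  then show ?thesis using r z by (auto simp: max_ideal_def vr_mult)
qed

text \<open>Of two nonzero elements one divides the other in \<open>V\<close>, so their sum is an
  element of \<open>V\<close> times one of them.\<close>

lemma mi_add: "z \<in> max_ideal V \<Longrightarrow> w \<in> max_ideal V \<Longrightarrow> z + w \<in> max_ideal V"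
proof -
  have *: "z + w \<in> max_ideal V"
    if z: "z \<in> max_ideal V" and w: "w \<in> max_ideal V" "w \<noteq> 0" and zw: "z / w \<in> V" for z w
  proof -
    have "z + w = (z / w + 1) * w" using w(2) by (simp add: distrib_right)
    then show ?thesis using mi_mult[OF vr_add[OF zw vr_1] w(1)] by simp
  qed
  assume z: "z \<in> max_ideal V" and w: "w \<in> max_ideal V"
  show ?thesis
  proof (cases "z = 0 \<or> w = 0")
    case False
    then have "z / w \<in> V \<or> w / z \<in> V"
      using vr_total[OF sf_divide[OF L], of z w] vr_sub mi_sub z w by fastforce
    then show ?thesis using *[of z w] *[of w z] False z w by (auto simp: add.commute)
  qed (use z w in auto)
qed

lemma mi_minus: "z \<in> max_ideal V \<Longrightarrow> - z \<in> max_ideal V"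
  using mi_mult[OF vr_const[of "- 1"]] by (simp add: emb_minus)

lemma mi_diff: "z \<in> max_ideal V \<Longrightarrow> w \<in> max_ideal V \<Longrightarrow> z - w \<in> max_ideal V"
  using mi_add[OF _ mi_minus] by fastforce

lemma vr_unit: "z \<in> V \<Longrightarrow> z \<notin> max_ideal V \<Longrightarrow> inverse z \<in> V"
  by (auto simp: max_ideal_def)

lemma mi_inverse: "z \<in> L \<Longrightarrow> z \<notin> V \<Longrightarrow> inverse z \<in> max_ideal V"
  using vr_total by (auto simp: max_ideal_def)

lemma unit_add_mi: "z \<in> max_ideal V \<Longrightarrow> inverse (1 + z) \<in> V"
proof -
  assume z: "z \<in> max_ideal V"
  have "1 + z \<notin> max_ideal V" using mi_diff[OF _ z, of "1 + z"] mi_one by auto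
  then show ?thesis using vr_unit vr_add[OF vr_1 mi_sub[OF z]] by blast
qed

lemma val_at_sub: "val_at V z a \<Longrightarrow> z \<in> V"
  unfolding val_at_def using vr_add[OF mi_sub vr_const, of "z - emb a" a] by simp

lemma val_at_unique: "val_at V z a \<Longrightarrow> val_at V z b \<Longrightarrow> a = b"
proof (rule ccontr)
  assume "val_at V z a" "val_at V z b" and ab: "a \<noteq> b"
  then have "emb (b - a) \<in> max_ideal V"
    using mi_diff[of "z - emb a" "z - emb b"] by (simp add: val_at_def emb_diff)
  then have "inverse (emb (b - a)) \<notin> V" using ab by (simp add: max_ideal_def)
  then show False using vr_const[of "inverse (b - a)"] by (simp only: emb_inverse)
qed

lemma val_at_const: "val_at V (emb a) a"
  by (simp add: val_at_def mi_0)

lemma val_at_1: "val_at V 1 1"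
  using val_at_const[of 1] by simp

lemma val_at_add: "val_at V z a \<Longrightarrow> val_at V w b \<Longrightarrow> val_at V (z + w) (a + b)"
  unfolding val_at_def using mi_add[of "z - emb a" "w - emb b"] by (simp add: emb_add algebra_simps)

lemma val_at_diff: "val_at V z a \<Longrightarrow> val_at V w b \<Longrightarrow> val_at V (z - w) (a - b)"
  unfolding val_at_def using mi_diff[of "z - emb a" "w - emb b"] by (simp add: emb_diff algebra_simps)

lemma val_at_mult: "val_at V z a \<Longrightarrow> val_at V w b \<Longrightarrow> val_at V (z * w) (a * b)"
proof -
  assume z: "val_at V z a" and w: "val_at V w b"
  have "z * w - emb (a * b) = w * (z - emb a) + emb a * (w - emb b)"
    by (simp add: algebra_simps emb_mult)
  moreover have "\<dots> \<in> max_ideal V"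
    using z w val_at_sub[OF w] by (intro mi_add mi_mult vr_const) (auto simp: val_at_def)
  ultimately show ?thesis by (simp add: val_at_def)
qed

lemma val_at_power: "val_at V z a \<Longrightarrow> val_at V (z ^ n) (a ^ n)"
  by (induction n) (simp_all add: val_at_1 val_at_mult)

lemma val_at_nonzero: "val_at V z a \<Longrightarrow> a \<noteq> 0 \<Longrightarrow> z \<noteq> 0 \<and> inverse z \<in> V"
proof -
  assume z: "val_at V z a" and a: "a \<noteq> 0"
  have "z \<notin> max_ideal V"
    using val_at_unique[OF z, of 0] a by (auto simp: val_at_def)
  then show ?thesis using vr_unit[OF val_at_sub[OF z]] mi_0 by auto
qed

lemma val_at_inverse: "val_at V z a \<Longrightarrow> a \<noteq> 0 \<Longrightarrow> val_at V (inverse z) (inverse a)"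
proof -
  assume z: "val_at V z a" and a: "a \<noteq> 0"
  note n = val_at_nonzero[OF z a]
  have "inverse z - emb (inverse a) = (- inverse z * emb (inverse a)) * (z - emb a)"
    using n a by (simp add: right_diff_distrib emb_inverse mult.assoc)
  moreover have "\<dots> \<in> max_ideal V"
    using z n by (intro mi_mult vr_mult vr_minus vr_const) (auto simp: val_at_def)
  ultimately show ?thesis by (simp add: val_at_def)
qed

lemma val_at_divide: "val_at V z a \<Longrightarrow> val_at V w b \<Longrightarrow> b \<noteq> 0 \<Longrightarrow> val_at V (z / w) (a / b)"
  by (simp add: field_class.field_divide_inverse val_at_mult val_at_inverse)

end

lemmas val_at_intros = val_at_const val_at_1 val_at_add val_at_diff val_at_mult val_at_power val_at_divide

lemma max_ideal_trace:
  assumes "const_subfield M" shows "max_ideal (V \<inter> M) = max_ideal V \<inter> M"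
  using sf_inverse_iff[OF assms] by (auto simp: max_ideal_def)

lemma val_at_trace:
  assumes "const_subfield M" "z \<in> M" shows "val_at (V \<inter> M) z a \<longleftrightarrow> val_at V z a"
  using sf_diff[OF assms(1,2) sf_const[OF assms(1)]] by (simp add: val_at_def max_ideal_trace[OF assms(1)])

text \<open>A proper inclusion would coarsen the valuation, although \<open>L\<close> is algebraic over \<open>M\<close>.\<close>

lemma val_ring_incomparable:
  assumes L: "const_subfield L" and M: "const_subfield M" "M \<subseteq> L"
    and quad: "\<And>z. z \<in> L \<Longrightarrow> \<exists>t\<in>M. \<exists>n\<in>M. z * z = t * z - n"
    and V: "val_ring L V" and V': "val_ring L V'" and eq: "V \<inter> M = V' \<inter> M" and sub: "V \<subseteq> V'"
  shows "V' \<subseteq> V"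
proof
  fix f assume f': "f \<in> V'"
  show "f \<in> V"
  proof (rule ccontr)
    assume f: "f \<notin> V"
    have fL: "f \<in> L" using vr_sub[OF L V' f'] .
    have f0: "f \<noteq> 0" using f vr_0[OF L V] by auto
    have fi: "inverse f \<in> V" using vr_total[OF L V fL f] .
    obtain t n where tn: "t \<in> M" "n \<in> M" "f * f = t * f - n" using quad[OF fL] by auto
    have tnL: "t \<in> L" "n \<in> L" using tn M by auto
    have eqM: "z \<in> V \<longleftrightarrow> z \<in> V'" if "z \<in> M" for z using eq that by auto
    have mi_eq: "z \<in> max_ideal V \<longleftrightarrow> z \<in> max_ideal V'" if "z \<in> M" for z
      using eqM[OF that] eqM[OF sf_inverse[OF M(1) that]] by (auto simp: max_ideal_def)
    \<comment> \<open>Enlarging a valuation ring shrinks its maximal ideal; on \<open>M\<close> the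
      two ideals agree by \<open>mi_eq\<close>.\<close>
    have mi_sub': "z \<in> max_ideal V" if z: "z \<in> max_ideal V'" for z
    proof (cases "z = 0")
      case False
      then have "inverse z \<notin> V" using z sub by (auto simp: max_ideal_def)
      moreover have "z \<in> L" using vr_sub[OF L V' mi_sub[OF z]] .
      ultimately show ?thesis
        using mi_inverse[OF L V sf_inverse[OF L]] by fastforce
    qed (simp add: mi_0[OF L V])
    \<comment> \<open>One of the coefficients 1, t, n of the quadratic equation divides the other
      two in \<open>V\<close>. Here 1 does, and f = t - n / f lies in \<open>V\<close>.\<close>
    have A: "\<not> (t \<in> V \<and> n \<in> V)"
    proof
      assume "t \<in> V \<and> n \<in> V"
      then have "t - n * inverse f \<in> V" by (intro vr_diff[OF L V] vr_mult[OF L V] fi) auto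
      moreover have "t - n * inverse f = f" using tn(3) f0 by (simp add: field_simps)
      ultimately show False using f by simp
    qed
    \<comment> \<open>The case where t divides 1 and n: then f (1 - f / t) = n / t, and 1 - f / t is
      a unit of \<open>V\<close> because f / t lies in both maximal ideals.\<close>
    have B: "\<not> (inverse t \<in> V \<and> n * inverse t \<in> V \<and> t \<noteq> 0)"
    proof
      assume a: "inverse t \<in> V \<and> n * inverse t \<in> V \<and> t \<noteq> 0"
      have "t \<notin> V"
      proof
        assume t: "t \<in> V"
        then have "n * inverse t * t \<in> V" using a by (intro vr_mult[OF L V _ t]) auto
        moreover have "n * inverse t * t = n" using a by simp
        ultimately have "n \<in> V" by metis
        then show False using A t by simp
      qed
      then have "inverse t \<in> max_ideal V" by (rule mi_inverse[OF L V tnL(1)])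
      then have "f * inverse t \<in> max_ideal V'"
        using mi_eq[OF sf_inverse[OF M(1) tn(1)]] by (intro mi_mult[OF L V' f']) auto
      then have "- (f * inverse t) \<in> max_ideal V" using mi_sub' mi_minus[OF L V] by blast
      then have "n * inverse t * inverse (1 + - (f * inverse t)) \<in> V"
        using a by (intro vr_mult[OF L V _ unit_add_mi[OF L V]]) auto
      moreover have "1 + - (f * inverse t) \<noteq> 0"
      proof
        assume "1 + - (f * inverse t) = 0"
        then have "1 = f * inverse t" by simp
        then show False using mi_one[OF L V'] \<open>f * inverse t \<in> max_ideal V'\<close> by simp
      qed
      moreover have "f * (1 + - (f * inverse t)) = n * inverse t"
        using tn(3) a by (simp add: field_simps)
      ultimately have "f \<in> V" by (metis nonzero_mult_div_cancel_right field_class.field_divide_inverse)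
      then show False using f by simp
    qed
    have n0: "n \<noteq> 0"
      using A B vr_total[OF L V tnL(1)] vr_0[OF L V] by fastforce
    have nV: "n \<notin> V"
    proof
      assume n: "n \<in> V"
      then have "t \<notin> V" using A by auto
      then have "inverse t \<in> V" "t \<noteq> 0" using vr_total[OF L V tnL(1)] vr_0[OF L V] by auto
      then show False using B vr_mult[OF L V n] by auto
    qed
    have ni: "inverse n \<in> max_ideal V" using mi_inverse[OF L V tnL(2) nV] .
    have ti: "t * inverse n \<in> max_ideal V"
    proof (rule ccontr)
      assume c: "t * inverse n \<notin> max_ideal V"
      have m: "t * inverse n \<in> L" using tnL by (intro sf_mult[OF L] sf_inverse[OF L])
      have "inverse (t * inverse n) \<in> V"
        using c vr_total[OF L V m] vr_unit[OF L V, of "t * inverse n"] by blast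
      then have "n * inverse t \<in> V" by (simp add: mult.commute)
      moreover have "t \<noteq> 0" using c mi_0[OF L V] by auto
      moreover have "inverse n * (n * inverse t) \<in> V"
        using calculation by (intro vr_mult[OF L V mi_sub[OF ni]])
      ultimately show False using B n0 by (simp flip: mult.assoc)
    qed
    have M': "inverse n \<in> M" "t * inverse n \<in> M" using tn by (auto intro: sf_intros M(1))
    \<comment> \<open>The remaining case: 1 / n and t / n lie in the maximal ideal of
      \<open>V\<close>, hence in that of \<open>V'\<close> since both are in \<open>M\<close>. The
      equation divided by n then puts 1 into the maximal ideal of \<open>V'\<close>.\<close>
    have "f * (t * inverse n) - (f * f) * inverse n \<in> max_ideal V'"
      using ni ti mi_eq[OF M'(1)] mi_eq[OF M'(2)]
      by (intro mi_diff[OF L V' mi_mult[OF L V' f'] mi_mult[OF L V' vr_mult[OF L V' f' f']]]) auto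
    moreover have "f * (t * inverse n) - (f * f) * inverse n = 1"
      using tn(3) n0 by (simp add: field_simps)
    ultimately show False using mi_one[OF L V'] by simp
  qed
qed


end

section \<open>Valuation rings in a quadratic extension with involution\<close>

locale involution = constant_embedding emb for emb :: "'a::field \<Rightarrow> 'b::field" +
  fixes L M :: "'b set" and \<sigma> :: "'b \<Rightarrow> 'b"
  assumes L: "const_subfield L" and M: "const_subfield M" "M \<subseteq> L"
    and \<sigma>_closed: "z \<in> L \<Longrightarrow> \<sigma> z \<in> L"
    and \<sigma>_add: "z \<in> L \<Longrightarrow> w \<in> L \<Longrightarrow> \<sigma> (z + w) = \<sigma> z + \<sigma> w"
    and \<sigma>_mult: "z \<in> L \<Longrightarrow> w \<in> L \<Longrightarrow> \<sigma> (z * w) = \<sigma> z * \<sigma> w"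
    and \<sigma>_fixed: "z \<in> M \<Longrightarrow> \<sigma> z = z"
    and \<sigma>_\<sigma>: "z \<in> L \<Longrightarrow> \<sigma> (\<sigma> z) = z"
    and trace: "z \<in> L \<Longrightarrow> z + \<sigma> z \<in> M" and norm: "z \<in> L \<Longrightarrow> z * \<sigma> z \<in> M"
begin

text \<open>z is a root of (Z - z)(Z - \<sigma> z), whose coefficients are its trace and
  norm.\<close>

lemma quadratic: "z \<in> L \<Longrightarrow> \<exists>t\<in>M. \<exists>n\<in>M. z * z = t * z - n"
  using trace norm by (intro bexI[of _ "z + \<sigma> z"] bexI[of _ "z * \<sigma> z"]) (simp_all add: algebra_simps)

lemma val_ring_eqI:
  assumes "val_ring L V" "val_ring L V'" "V \<inter> M = V' \<inter> M" "V \<subseteq> V'"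
  shows "V' = V"
  using val_ring_incomparable[OF L M quadratic assms] assms(4) by blast

lemma \<sigma>_inverse: "z \<in> L \<Longrightarrow> \<sigma> (inverse z) = inverse (\<sigma> z)"
proof (cases "z = 0")
  case False
  assume z: "z \<in> L"
  have "\<sigma> (inverse z) * \<sigma> z = 1"
    using \<sigma>_mult[OF sf_inverse[OF L z] z] False \<sigma>_fixed[OF sf_1[OF M(1)]] by simp
  then show ?thesis using inverse_unique[of "\<sigma> (inverse z)" "\<sigma> z"] by (metis inverse_inverse_eq)
qed (use \<sigma>_fixed[OF sf_0[OF M(1)]] in auto)

lemma conjugate_mem: "z \<in> L \<Longrightarrow> V \<subseteq> L \<Longrightarrow> z \<in> \<sigma> ` V \<longleftrightarrow> \<sigma> z \<in> V"
  using \<sigma>_\<sigma> by (force simp: image_iff)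

lemma conjugate_val_ring:
  assumes V: "val_ring L V" shows "val_ring L (\<sigma> ` V)" "\<sigma> ` V \<inter> M = V \<inter> M"
proof -
  have sub: "V \<subseteq> L" using V by (simp add: val_ring_def)
  have sL: "\<sigma> ` V \<subseteq> L" using sub \<sigma>_closed by auto
  have mem: "z \<in> \<sigma> ` V \<longleftrightarrow> z \<in> L \<and> \<sigma> z \<in> V" for z using sub sL conjugate_mem by blast
  have ne: "\<sigma> ` V \<noteq> L"
  proof
    assume "\<sigma> ` V = L"
    then have "\<sigma> (\<sigma> z) \<in> V" if "z \<in> L" for z using mem \<sigma>_closed[OF that] by blast
    then have "L \<subseteq> V" using \<sigma>_\<sigma> by auto
    then show False using V by (auto simp: val_ring_def)
  qed
  show "val_ring L (\<sigma> ` V)"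
    unfolding val_ring_def
  proof (intro conjI ballI sL ne)
    show "range emb \<subseteq> \<sigma> ` V"
      using vr_const[OF L V] sf_const[OF L] \<sigma>_fixed[OF sf_const[OF M(1)]] by (auto simp: mem)
    fix z assume z: "z \<in> L"
    then show "z \<in> \<sigma> ` V \<or> inverse z \<in> \<sigma> ` V"
      using vr_total[OF L V \<sigma>_closed[OF z]] sf_inverse[OF L z] by (auto simp: mem \<sigma>_inverse)
  qed (auto simp: mem \<sigma>_add \<sigma>_mult sf_add[OF L] sf_mult[OF L] vr_add[OF L V] vr_mult[OF L V])
  show "\<sigma> ` V \<inter> M = V \<inter> M"
  proof (rule Set.set_eqI)
    fix z show "z \<in> \<sigma> ` V \<inter> M \<longleftrightarrow> z \<in> V \<inter> M"
      unfolding Int_iff mem using M(2) \<sigma>_fixed[of z] by auto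
  qed
qed

text \<open>Weak approximation for two places: incomparability supplies f in \<open>V'\<close>
  outside \<open>V\<close> and h in \<open>V\<close> outside \<open>V'\<close>, and the quotient f /
  h vanishes at \<open>V'\<close> but has a pole at \<open>V\<close>.\<close>

lemma separating_element:
  assumes V: "val_ring L V" and V': "val_ring L V'" "V \<inter> M = V' \<inter> M" "V \<noteq> V'"
  shows "\<exists>g \<in> max_ideal V'. g \<notin> V"
proof -
  obtain f where f: "f \<in> V'" "f \<notin> V" using val_ring_eqI[OF V'(1) V V'(2)[symmetric]] V'(3) by blast
  obtain h where h: "h \<in> V" "h \<notin> V'"
    using val_ring_eqI[OF V V'(1,2)] V'(3) by blast
  have "f * inverse h \<in> max_ideal V'"
    using h vr_sub[OF L V] by (intro mi_mult[OF L V'(1) f(1)] mi_inverse[OF L V'(1)])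
  moreover have "f * inverse h \<notin> V"
  proof
    assume "f * inverse h \<in> V"
    then have "f * inverse h * h \<in> V" using h by (intro vr_mult[OF L V, of "f * inverse h"])
    moreover have "h \<noteq> 0" using h vr_0[OF L V'(1)] by auto
    ultimately show False using f(2) by (simp add: mult.assoc)
  qed
  ultimately show ?thesis by blast
qed

text \<open>If \<open>V'\<close> were a third extension, some \<open>e\<close> would be congruent to 1 at \<open>V'\<close> while \<open>e\<close> and its
  conjugate vanish at \<open>V\<close>; then trace and norm of \<open>e\<close> vanish at \<open>V'\<close> as well, and so does \<open>e\<close>.\<close>

lemma val_ring_fibre:
  assumes V: "val_ring L V" and V': "val_ring L V'" and eq: "V \<inter> M = V' \<inter> M"
  shows "V' = V \<or> V' = \<sigma> ` V"
proof (rule ccontr)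
  assume c: "\<not> (V' = V \<or> V' = \<sigma> ` V)"
  define W where "W = \<sigma> ` V"
  have W: "val_ring L W" "W \<inter> M = V' \<inter> M" using conjugate_val_ring[OF V] eq by (auto simp: W_def)
  obtain g where g: "g \<in> max_ideal V'" "g \<notin> V" using separating_element[OF V V' eq] c by auto
  obtain g' where g': "g' \<in> max_ideal V'" "g' \<notin> W"
    using separating_element[OF W(1) V' W(2)] c by (auto simp: W_def)
  \<comment> \<open>If neither g nor g' has a pole at both \<open>V\<close> and \<open>W\<close>,
    each has a pole exactly where the other is regular, so no pole of the sum cancels.\<close>
  have "\<exists>h\<in>max_ideal V'. h \<notin> V \<and> h \<notin> W"
  proof (cases "g \<in> W \<and> g' \<in> V")
    case True
    have "g + g' \<notin> V" using vr_diff[OF L V, of "g + g'" g'] g True by auto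
    moreover have "g + g' \<notin> W" using vr_diff[OF L W(1), of "g + g'" g] g' True by auto
    ultimately show ?thesis using mi_add[OF L V' g(1) g'(1)] by blast
  qed (use g g' in auto)
  then obtain h where h: "h \<in> max_ideal V'" "h \<notin> V" "h \<notin> W" by blast
  have hL: "h \<in> L" using vr_sub[OF L V' mi_sub[OF h(1)]] .
  have h1L: "1 + h \<in> L" using hL by (intro sf_intros L)
  have h1: "1 + h \<noteq> 0" using mi_minus[OF L V' h(1)] mi_one[OF L V']
    by (auto simp: add_eq_0_iff)
  \<comment> \<open>A zero of h at \<open>V'\<close> makes e congruent to 1 there; the poles of h at
    \<open>V\<close> and \<open>W\<close> become zeros of e.\<close>
  define e where "e = inverse (1 + h)"
  have eL: "e \<in> L" unfolding e_def by (rule sf_inverse[OF L h1L])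
  have "1 + h \<notin> V" using vr_diff[OF L V _ vr_1[OF L V], of "1 + h"] h by auto
  then have eV: "e \<in> max_ideal V" unfolding e_def by (rule mi_inverse[OF L V h1L])
  have "1 + h \<notin> W" using vr_diff[OF L W(1) _ vr_1[OF L W(1)], of "1 + h"] h by auto
  then have eW: "e \<in> max_ideal W" unfolding e_def by (rule mi_inverse[OF L W(1) h1L])
  have sub: "V \<subseteq> L" using V by (simp add: val_ring_def)
  \<comment> \<open>\<sigma> carries \<open>W\<close> to \<open>V\<close>, so the zero of e at
    \<open>W\<close> is a zero of \<sigma> e at \<open>V\<close>.\<close>
  have seV: "\<sigma> e \<in> max_ideal V"
    using eW conjugate_mem[OF eL sub] conjugate_mem[OF sf_inverse[OF L eL] sub] \<sigma>_inverse[OF eL]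
    by (auto simp: max_ideal_def W_def \<sigma>_fixed[OF sf_0[OF M(1)]])
  have "max_ideal V \<inter> M = max_ideal V' \<inter> M"
    using eq max_ideal_trace[OF M(1), of V] max_ideal_trace[OF M(1), of V'] by simp
  then have T: "e + \<sigma> e \<in> max_ideal V'" and N: "e * \<sigma> e \<in> max_ideal V'"
    using mi_add[OF L V eV seV] trace[OF eL] mi_mult[OF L V mi_sub[OF eV] seV] norm[OF eL] by blast+
  have eV': "e \<in> V'" unfolding e_def by (rule unit_add_mi[OF L V' h(1)])
  \<comment> \<open>Trace and norm vanish at \<open>V'\<close>, hence so does e^2; multiplying by (1
    + h)^2 turns this into the vanishing of 1.\<close>
  have "e * e = e * (e + \<sigma> e) - e * \<sigma> e" by (simp add: algebra_simps)
  then have "e * e \<in> max_ideal V'"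
    using mi_diff[OF L V' mi_mult[OF L V' eV' T] N] by simp
  moreover have "1 + h \<in> V'" using vr_add[OF L V' vr_1[OF L V'] mi_sub[OF h(1)]] .
  ultimately have "(1 + h) * (1 + h) * (e * e) \<in> max_ideal V'" 
    by (intro mi_mult[OF L V' vr_mult[OF L V']])
  moreover have "(1 + h) * (1 + h) * (e * e) = ((1 + h) * e) * ((1 + h) * e)" by (simp only: mult_ac)
  then have "(1 + h) * (1 + h) * (e * e) = 1" using h1 by (simp add: e_def)
  ultimately show False using mi_one[OF L V'] by simp
qed

text \<open>Only properness needs an argument. If \<open>V\<close> contained \<open>M\<close>, any z
  outside \<open>V\<close> would satisfy z = t - n / z with t, n and 1 / z in
  \<open>V\<close>.\<close>

lemma val_ring_restrict:
  assumes V: "val_ring L V" shows "val_ring M (V \<inter> M)"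
proof -
  have "V \<inter> M \<noteq> M"
  proof
    assume "V \<inter> M = M"
    then have MV: "M \<subseteq> V" by auto
    have "z \<in> V" if z: "z \<in> L" for z
    proof (rule ccontr)
      assume nz: "z \<notin> V"
      obtain t n where tn: "t \<in> M" "n \<in> M" "z * z = t * z - n" using quadratic[OF z] by auto
      have "t - n * inverse z \<in> V"
        using vr_total[OF L V z nz] tn MV by (intro vr_diff[OF L V] vr_mult[OF L V]) auto
      moreover have "z \<noteq> 0" using nz vr_0[OF L V] by auto
      then have "t - n * inverse z = z" using tn(3) by (simp add: field_simps)
      ultimately show False using nz by simp
    qed
    then show False using V by (auto simp: val_ring_def)
  qed
  moreover have "z \<in> V \<or> inverse z \<in> V" if "z \<in> M" for z
    using vr_total[OF L V] that M(2) by blast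
  ultimately show ?thesis
    using vr_const[OF L V] vr_add[OF L V] vr_mult[OF L V]
    by (auto simp: val_ring_def sf_const[OF M(1)] sf_add[OF M(1)] sf_mult[OF M(1)] sf_inverse[OF M(1)])
qed

end


section \<open>Curves modelled by subfields\<close>

text \<open>Elements of a plane function field are cosets of fractions in a record structure. The
  embedding \<psi> moves all computation into the field type \<open>'b\<close>, where places become
  the sets described by \<open>val_ring\<close>.\<close>

locale field_model = constant_embedding emb for emb :: "'a::field \<Rightarrow> 'b::field" +
  fixes F :: "('f, 'a) function_field" and \<psi> :: "'f \<Rightarrow> 'b"
  assumes field_F: "field F" and \<psi>_inj: "inj_on \<psi> (carrier F)"
    and \<psi>_one: "\<psi> \<one>\<^bsub>F\<^esub> = 1"
    and \<psi>_mult: "f \<in> carrier F \<Longrightarrow> g \<in> carrier F \<Longrightarrow> \<psi> (f \<otimes>\<^bsub>F\<^esub> g) = \<psi> f * \<psi> g"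
    and \<psi>_add: "f \<in> carrier F \<Longrightarrow> g \<in> carrier F \<Longrightarrow> \<psi> (f \<oplus>\<^bsub>F\<^esub> g) = \<psi> f + \<psi> g"
    and const_closed: "const F a \<in> carrier F" and \<psi>_const: "\<psi> (const F a) = emb a"
begin

sublocale R: field F by (rule field_F)

lemma \<psi>_zero: "\<psi> \<zero>\<^bsub>F\<^esub> = 0"
proof -
  have "\<psi> \<zero>\<^bsub>F\<^esub> + \<psi> \<zero>\<^bsub>F\<^esub> = \<psi> \<zero>\<^bsub>F\<^esub> + 0" using \<psi>_add[of "\<zero>\<^bsub>F\<^esub>" "\<zero>\<^bsub>F\<^esub>"] by simp
  then show ?thesis by (rule add_left_imp_eq)
qed

lemma \<psi>_eq_0_iff: "f \<in> carrier F \<Longrightarrow> \<psi> f = 0 \<longleftrightarrow> f = \<zero>\<^bsub>F\<^esub>"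
  using inj_on_eq_iff[OF \<psi>_inj, of f "\<zero>\<^bsub>F\<^esub>"] by (simp add: \<psi>_zero)

lemma \<psi>_uminus: "f \<in> carrier F \<Longrightarrow> \<psi> (\<ominus>\<^bsub>F\<^esub> f) = - \<psi> f"
  using \<psi>_add[of "\<ominus>\<^bsub>F\<^esub> f" f] by (simp add: R.l_neg \<psi>_zero eq_neg_iff_add_eq_0)

lemma \<psi>_minus: "f \<in> carrier F \<Longrightarrow> g \<in> carrier F \<Longrightarrow> \<psi> (f \<ominus>\<^bsub>F\<^esub> g) = \<psi> f - \<psi> g"
  by (simp add: R.minus_eq \<psi>_add \<psi>_uminus)

lemma inv_closed: "f \<in> carrier F \<Longrightarrow> f \<noteq> \<zero>\<^bsub>F\<^esub> \<Longrightarrow> inv\<^bsub>F\<^esub> f \<in> carrier F"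
  by (simp add: R.field_Units)

lemma \<psi>_inv: "f \<in> carrier F \<Longrightarrow> f \<noteq> \<zero>\<^bsub>F\<^esub> \<Longrightarrow> \<psi> (inv\<^bsub>F\<^esub> f) = inverse (\<psi> f)"
proof -
  assume f: "f \<in> carrier F" "f \<noteq> \<zero>\<^bsub>F\<^esub>"
  have "\<psi> f * \<psi> (inv\<^bsub>F\<^esub> f) = 1"
    using f \<psi>_mult[OF f(1) inv_closed[OF f]] by (simp add: R.field_Units \<psi>_one)
  then show ?thesis by (rule inverse_unique[symmetric])
qed

abbreviation L where "L \<equiv> \<psi> ` carrier F"

lemma subfield_L: "const_subfield L"
proof (rule const_subfieldI)
  show "emb a \<in> L" for a using \<psi>_const const_closed by (metis imageI)
  fix z w assume z: "z \<in> L" and w: "w \<in> L"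
  then obtain f g where fg: "f \<in> carrier F" "g \<in> carrier F" "z = \<psi> f" "w = \<psi> g" by auto
  show "z + w \<in> L" "z * w \<in> L" using fg by (auto simp flip: \<psi>_add \<psi>_mult)
next
  fix z assume z: "z \<in> L" "z \<noteq> 0"
  then obtain f where f: "f \<in> carrier F" "z = \<psi> f" by auto
  then have "f \<noteq> \<zero>\<^bsub>F\<^esub>" using z by (auto simp: \<psi>_zero)
  then show "inverse z \<in> L" using f inv_closed by (auto simp flip: \<psi>_inv)
qed

lemma image_mem_iff: "P \<subseteq> carrier F \<Longrightarrow> f \<in> carrier F \<Longrightarrow> \<psi> f \<in> \<psi> ` P \<longleftrightarrow> f \<in> P"
  using \<psi>_inj by (rule inj_on_image_mem_iff)

lemma places_carrier: "P \<in> places F \<Longrightarrow> P \<subseteq> carrier F"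
  by (auto simp: places_def dest: subringE(1))

lemma places_val_ring:
  assumes "P \<in> places F" shows "val_ring L (\<psi> ` P)"
proof -
  have P: "subring P F" "range (const F) \<subseteq> P" "P \<noteq> carrier F"
    "\<And>z. z \<in> carrier F \<Longrightarrow> z \<noteq> \<zero>\<^bsub>F\<^esub> \<Longrightarrow> z \<in> P \<or> inv\<^bsub>F\<^esub> z \<in> P"
    using assms by (auto simp: places_def)
  note sub = places_carrier[OF assms]
  show ?thesis
    unfolding val_ring_def
  proof (intro conjI ballI)
    show "\<psi> ` P \<subseteq> L" using sub by auto
    show "\<psi> ` P \<noteq> L" using P(3) sub \<psi>_inj by (metis inj_on_image_eq_iff order_refl)
    show "range emb \<subseteq> \<psi> ` P" using P(2) by (auto simp flip: \<psi>_const)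
  next
    fix z w assume "z \<in> \<psi> ` P" "w \<in> \<psi> ` P"
    then obtain f g where fg: "f \<in> P" "g \<in> P" "z = \<psi> f" "w = \<psi> g" by auto
    then have "z + w = \<psi> (f \<oplus>\<^bsub>F\<^esub> g)" "z * w = \<psi> (f \<otimes>\<^bsub>F\<^esub> g)" using sub by (auto simp: \<psi>_add \<psi>_mult subset_iff)
    then show "z + w \<in> \<psi> ` P" "z * w \<in> \<psi> ` P" using fg subringE(6,7)[OF P(1)] by auto
  next
    fix z assume "z \<in> L"
    then obtain f where f: "f \<in> carrier F" "z = \<psi> f" by auto
    show "z \<in> \<psi> ` P \<or> inverse z \<in> \<psi> ` P"
    proof (cases "f = \<zero>\<^bsub>F\<^esub>")
      case True
      then show ?thesis using f subringE(2)[OF P(1)] by auto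
    next
      case False
      then show ?thesis using P(4)[OF f(1) False] f by (auto simp flip: \<psi>_inv)
    qed
  qed
qed

text \<open>Points are constructed this way: the origin from a ring of Laurent series of nonnegative
  order, the image of a point under the isogeny from a trace on \<open>M\<close>.\<close>

lemma val_ring_places:
  assumes V: "val_ring L V" shows "{f \<in> carrier F. \<psi> f \<in> V} \<in> places F" (is "?P \<in> _")
    and "\<psi> ` {f \<in> carrier F. \<psi> f \<in> V} = V"
proof -
  show im: "\<psi> ` ?P = V" using V by (auto simp: val_ring_def)
  have "subring ?P F"
    using vr_1[OF subfield_L V] vr_minus[OF subfield_L V] vr_mult[OF subfield_L V] vr_add[OF subfield_L V]
    by (intro R.subringI) (auto simp: \<psi>_one \<psi>_uminus \<psi>_mult \<psi>_add)
  moreover have "range (const F) \<subseteq> ?P"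
    using vr_const[OF subfield_L V] const_closed by (auto simp: \<psi>_const)
  moreover have "?P \<noteq> carrier F" using im V by (auto simp: val_ring_def)
  moreover have "z \<in> ?P \<or> inv\<^bsub>F\<^esub> z \<in> ?P" if "z \<in> carrier F" "z \<noteq> \<zero>\<^bsub>F\<^esub>" for z
    using that vr_total[OF subfield_L V, of "\<psi> z"] inv_closed[OF that] by (auto simp: \<psi>_inv)
  ultimately show "?P \<in> places F" by (auto simp: places_def)
qed

lemma has_value_iff:
  assumes P: "P \<subseteq> carrier F" and f: "f \<in> carrier F"
  shows "has_value F P f a \<longleftrightarrow> val_at (\<psi> ` P) (\<psi> f) a"
proof -
  define g where "g = f \<ominus>\<^bsub>F\<^esub> const F a"
  have g: "g \<in> carrier F" "\<psi> g = \<psi> f - emb a"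
    using f const_closed by (auto simp: g_def \<psi>_minus \<psi>_const)
  have "g \<in> place_ideal F P \<longleftrightarrow> \<psi> g \<in> max_ideal (\<psi> ` P)"
  proof (cases "g = \<zero>\<^bsub>F\<^esub>")
    case False
    then show ?thesis
      using image_mem_iff[OF P g(1)] image_mem_iff[OF P inv_closed[OF g(1) False]] \<psi>_eq_0_iff[OF g(1)]
      by (auto simp: place_ideal_def max_ideal_def \<psi>_inv[OF g(1) False])
  qed (use image_mem_iff[OF P g(1)] in \<open>auto simp: place_ideal_def max_ideal_def \<psi>_zero\<close>)
  then show ?thesis using f g by (simp add: has_value_def val_at_def flip: g_def)
qed

end

lemma (in ring) line_extension_eq:
  "line_extension K a E = {k \<otimes> a \<oplus> e | k e. k \<in> K \<and> e \<in> E}"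
  by (auto simp: line_extension_def set_add_def' r_coset_def)

locale quadratic_cover =
  involution emb L M \<sigma> + F: field_model emb F \<psi> + G: field_model emb G \<chi>
  for emb :: "'a::field \<Rightarrow> 'b::field" and L M \<sigma>
    and F :: "('f, 'a) function_field" and \<psi> and G :: "('g, 'a) function_field" and \<chi> +
  fixes w
  assumes L_eq: "\<psi> ` carrier F = L" and M_eq: "\<chi> ` carrier G = M"
    and w: "w \<in> L" "w \<notin> M" and L_basis: "L = {a + b * w | a b. a \<in> M \<and> b \<in> M}"
begin

definition \<phi> :: "'f set \<Rightarrow> 'g set" where
  "\<phi> P = {f \<in> carrier G. \<chi> f \<in> \<psi> ` P}"

lemma \<phi>_carrier: "\<phi> P \<subseteq> carrier G"
  by (auto simp: \<phi>_def)

lemma image_\<phi>: "\<chi> ` \<phi> P = \<psi> ` P \<inter> M"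
  unfolding \<phi>_def M_eq[symmetric] by (auto simp: image_iff Bex_def, metis)

lemma \<phi>_places: "P \<in> places F \<Longrightarrow> \<phi> P \<in> places G"
proof -
  assume "P \<in> places F"
  then have "val_ring (\<chi> ` carrier G) (\<psi> ` P \<inter> M)"
    using val_ring_restrict F.places_val_ring by (simp add: L_eq M_eq)
  from G.val_ring_places(1)[OF this] show ?thesis
    by (simp add: \<phi>_def flip: M_eq cong: conj_cong)
qed

lemma val_at_\<phi>:
  assumes "P \<in> places F" "f \<in> carrier G"
  shows "has_value G (\<phi> P) f a \<longleftrightarrow> val_at (\<psi> ` P) (\<chi> f) a"
proof -
  have "\<chi> f \<in> M" using assms by (simp flip: M_eq)
  then show ?thesis
    using G.has_value_iff[OF \<phi>_carrier assms(2)] val_at_trace[OF M(1)] by (simp add: image_\<phi>)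
qed

text \<open>The inclusion of \<open>M\<close> in \<open>L\<close>, read in the abstract function
  fields.\<close>

definition \<theta> :: "'g \<Rightarrow> 'f" where
  "\<theta> g = inv_into (carrier F) \<psi> (\<chi> g)"

lemma \<theta>: "g \<in> carrier G \<Longrightarrow> \<theta> g \<in> carrier F \<and> \<psi> (\<theta> g) = \<chi> g"
proof -
  assume "g \<in> carrier G"
  then have "\<chi> g \<in> \<psi> ` carrier F" using M(2) by (auto simp flip: M_eq simp: L_eq)
  then show ?thesis by (simp add: \<theta>_def inv_into_into f_inv_into_f)
qed

lemma \<theta>_eqI: "g \<in> carrier G \<Longrightarrow> f \<in> carrier F \<Longrightarrow> \<psi> f = \<chi> g \<Longrightarrow> \<theta> g = f"
  using \<theta>[of g] inj_onD[OF F.\<psi>_inj, of "\<theta> g" f] by auto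

lemma comorphism: "comorphism F G \<phi> \<theta>"
  unfolding comorphism_def
proof (intro conjI allI ballI)
  show "\<theta> \<in> ring_hom G F"
    using \<theta> by (intro ring_hom_memI \<theta>_eqI)
      (auto simp: F.\<psi>_mult F.\<psi>_add F.\<psi>_one G.\<psi>_mult G.\<psi>_add G.\<psi>_one)
  show "\<theta> (const G a) = const F a" for a
    by (intro \<theta>_eqI) (auto simp: F.\<psi>_const G.\<psi>_const F.const_closed G.const_closed)
  fix P f assume P: "P \<in> places F" and f: "f \<in> \<phi> P"
  then have fG: "f \<in> carrier G" "\<chi> f \<in> \<psi> ` P" by (auto simp: \<phi>_def)
  then show "\<theta> f \<in> P"
    using \<theta>[of f] F.image_mem_iff[OF F.places_carrier[OF P], of "\<theta> f"] by simp
  show "has_value F P (\<theta> f) a \<longleftrightarrow> has_value G (\<phi> P) f a" for a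
    using val_at_\<phi>[OF P fG(1)] F.has_value_iff[OF F.places_carrier[OF P], of "\<theta> f"] \<theta>[OF fG(1)] by simp
qed

lemma finite_fibre: "finite {P \<in> places F. \<phi> P = Q}"
proof (cases "\<exists>P0 \<in> places F. \<phi> P0 = Q")
  case True
  then obtain P0 where P0: "P0 \<in> places F" "\<phi> P0 = Q" by auto
  have "(\<lambda>P. \<psi> ` P) ` {P \<in> places F. \<phi> P = Q} \<subseteq> {\<psi> ` P0, \<sigma> ` (\<psi> ` P0)}"
  proof (rule image_subsetI)
    fix P assume P: "P \<in> {P \<in> places F. \<phi> P = Q}"
    have "\<psi> ` P0 \<inter> M = \<psi> ` P \<inter> M" using P0 P image_\<phi>[of P] image_\<phi>[of P0] by auto
    then show "\<psi> ` P \<in> {\<psi> ` P0, \<sigma> ` (\<psi> ` P0)}"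
      using val_ring_fibre[of "\<psi> ` P0" "\<psi> ` P"] P P0 F.places_val_ring by (auto simp: L_eq)
  qed
  then have "finite ((\<lambda>P. \<psi> ` P) ` {P \<in> places F. \<phi> P = Q})" by (rule finite_subset) simp
  moreover have "inj_on (\<lambda>P. \<psi> ` P) {P \<in> places F. \<phi> P = Q}"
    using F.places_carrier F.\<psi>_inj by (intro inj_onI) (auto simp: inj_on_image_eq_iff)
  ultimately show ?thesis by (rule finite_imageD)
next
  case False
  then have "{P \<in> places F. \<phi> P = Q} = {}" by auto
  then show ?thesis by (simp only: finite.emptyI)
qed

text \<open>Continuity amounts to finite fibres: the complement of a preimage is a union of fibres
  over the finite complement of the open set. Pulled-back functions are given by \<theta>.\<close>

lemma curve_morphism: "curve_morphism F G \<phi>"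
  unfolding curve_morphism_def
proof (intro conjI allI impI ballI)
  show "\<phi> ` places F \<subseteq> places G" using \<phi>_places by auto
next
  fix V assume V: "curve_open G V"
  show "curve_open F {P \<in> places F. \<phi> P \<in> V}"
  proof (cases "V = {}")
    case False
    then have fin: "finite (places G - V)" using V by (auto simp: curve_open_def)
    have "places F - {P \<in> places F. \<phi> P \<in> V} = (\<Union>Q \<in> places G - V. {P \<in> places F. \<phi> P = Q})"
      using \<phi>_places by auto
    then show ?thesis using fin finite_fibre by (auto simp: curve_open_def)
  qed (auto simp: curve_open_def)
  fix f assume f: "f \<in> regular_on G V"
  have "\<theta> f \<in> regular_on F {P \<in> places F. \<phi> P \<in> V}"
    using f \<theta>[of f] comorphism by (auto simp: regular_on_def comorphism_def)
  moreover have "\<forall>P\<in>places F. \<phi> P \<in> V \<longrightarrow> (\<forall>a. has_value F P (\<theta> f) a \<longleftrightarrow> has_value G (\<phi> P) f a)"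
    using f comorphism by (auto simp: regular_on_def comorphism_def)
  ultimately show "\<exists>g\<in>regular_on F {P \<in> places F. \<phi> P \<in> V}. \<forall>P\<in>places F. \<phi> P \<in> V \<longrightarrow>
      (\<forall>a. has_value F P g a \<longleftrightarrow> has_value G (\<phi> P) f a)" by blast
qed

text \<open>\<open>dimension\<close> counts successive line extensions: the zero space is extended
  by 1 to the image of \<theta>, and this by the preimage of \<open>w\<close> to the whole
  field.\<close>

lemma degree: "has_degree F G \<phi> 2"
proof -
  define K where "K = \<theta> ` carrier G"
  have K: "K \<subseteq> carrier F" using \<theta> by (auto simp: K_def)
  have mem: "f \<in> K \<longleftrightarrow> f \<in> carrier F \<and> \<psi> f \<in> M" for f
  proof
    assume "f \<in> K" then show "f \<in> carrier F \<and> \<psi> f \<in> M" using \<theta> by (auto simp: K_def simp flip: M_eq)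
  next
    assume f: "f \<in> carrier F \<and> \<psi> f \<in> M"
    then obtain g where "g \<in> carrier G" "\<psi> f = \<chi> g" by (auto simp flip: M_eq)
    then show "f \<in> K" using f \<theta>_eqI[of g f] by (auto simp: K_def)
  qed
  obtain v where v: "v \<in> carrier F" "\<psi> v = w" using w(1) by (auto simp flip: L_eq)
  have "F.R.dimension (Suc 0) K (F.R.line_extension K \<one>\<^bsub>F\<^esub> {\<zero>\<^bsub>F\<^esub>})"
    by (rule F.R.Suc_dim) (auto intro: F.R.zero_dim)
  moreover have "F.R.line_extension K \<one>\<^bsub>F\<^esub> {\<zero>\<^bsub>F\<^esub>} = K"
  proof -
    have "k \<otimes>\<^bsub>F\<^esub> \<one>\<^bsub>F\<^esub> \<oplus>\<^bsub>F\<^esub> \<zero>\<^bsub>F\<^esub> = k" if "k \<in> K" for k using that K by auto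
    then show ?thesis unfolding F.R.line_extension_eq by force
  qed
  ultimately have "F.R.dimension (Suc 0) K K" by simp
  moreover have "v \<notin> K" using mem v w(2) by simp
  ultimately have "F.R.dimension (Suc (Suc 0)) K (F.R.line_extension K v K)"
    by (intro F.R.Suc_dim v)
  moreover have "F.R.line_extension K v K = carrier F"
  proof
    show "F.R.line_extension K v K \<subseteq> carrier F" using K v by (auto simp: F.R.line_extension_eq)
    show "carrier F \<subseteq> F.R.line_extension K v K"
    proof
      fix f assume f: "f \<in> carrier F"
      then have "\<psi> f \<in> L" by (auto simp flip: L_eq)
      then obtain a b where ab: "\<psi> f = a + b * w" "a \<in> M" "b \<in> M" using L_basis by auto
      have "a \<in> \<psi> ` carrier F" "b \<in> \<psi> ` carrier F" using ab M(2) by (auto simp: L_eq)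
      then obtain a' b' where ab': "a' \<in> carrier F" "b' \<in> carrier F" "a = \<psi> a'" "b = \<psi> b'"
        by blast
      then have "\<psi> f = \<psi> (b' \<otimes>\<^bsub>F\<^esub> v \<oplus>\<^bsub>F\<^esub> a')" using ab v by (simp add: F.\<psi>_add F.\<psi>_mult)
      then have "f = b' \<otimes>\<^bsub>F\<^esub> v \<oplus>\<^bsub>F\<^esub> a'" using F.\<psi>_inj f ab' v by (auto dest: inj_onD)
      then show "f \<in> F.R.line_extension K v K"
        using ab ab' mem unfolding F.R.line_extension_eq by blast
    qed
  qed
  ultimately show ?thesis
    using comorphism unfolding has_degree_def K_def numeral_2_eq_2 by auto
qed

end


section \<open>The function field of a plane curve as a subfield\<close>

text \<open>Applied at two levels: to \<open>emb\<close> on coefficients in the constants, then to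
  \<open>ev1 u\<close> on coefficients that are themselves polynomials.\<close>

lemma
  fixes f :: "'a::comm_ring_1 \<Rightarrow> 'b::comm_ring_1"
  assumes f: "f 0 = 0" "\<And>a b. f (a + b) = f a + f b" "\<And>a b. f (a * b) = f a * f b"
  shows map_poly_add_hom: "map_poly f (p + q) = map_poly f p + map_poly f q"
    and map_poly_mult_hom: "map_poly f (p * q) = map_poly f p * map_poly f q"
proof -
  show "map_poly f (p + q) = map_poly f p + map_poly f q"
    by (rule poly_eqI) (simp add: coeff_map_poly f)
  have "f (sum g A) = (\<Sum>i\<in>A. f (g i))" for g and A :: "nat set"
    using sum_comp_morphism[of f g A] f by (simp add: o_def)
  then show "map_poly f (p * q) = map_poly f p * map_poly f q"
    by (intro poly_eqI) (simp add: coeff_map_poly coeff_mult f)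
qed

section \<open>Evaluation of bivariate polynomials, fractions and cosets at a point\<close>

context constant_embedding
begin

definition ev1 :: "'b \<Rightarrow> 'a poly \<Rightarrow> 'b" where
  "ev1 u q = poly (map_poly emb q) u"

definition ev :: "'b \<Rightarrow> 'b \<Rightarrow> 'a poly poly \<Rightarrow> 'b" where
  "ev u v g = poly (map_poly (ev1 u) g) v"

lemma ev1_0 [simp]: "ev1 u 0 = 0" and ev1_1 [simp]: "ev1 u 1 = 1"
  and ev1_add: "ev1 u (p + q) = ev1 u p + ev1 u q"
  and ev1_mult: "ev1 u (p * q) = ev1 u p * ev1 u q"
  and ev1_pCons: "ev1 u (pCons a q) = emb a + u * ev1 u q"
  by (simp_all add: ev1_def map_poly_add_hom map_poly_mult_hom map_poly_pCons emb_add emb_mult)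

lemma ev_0 [simp]: "ev u v 0 = 0" and ev_1 [simp]: "ev u v 1 = 1"
  and ev_add: "ev u v (p + q) = ev u v p + ev u v q"
  and ev_mult: "ev u v (p * q) = ev u v p * ev u v q"
  and ev_pCons: "ev u v (pCons a g) = ev1 u a + v * ev u v g"
  by (simp_all add: ev_def map_poly_add_hom map_poly_mult_hom map_poly_pCons ev1_add ev1_mult)

lemma ev_const: "ev u v [:[:a:]:] = emb a" and ev_var_x [simp]: "ev u v var_x = u"
  and ev_var_y [simp]: "ev u v var_y = v"
  by (simp_all add: ev_pCons ev1_pCons var_x_def var_y_def)

lemma ev_minus: "ev u v (- g) = - ev u v g"
  using ev_add[of u v "- g" g] by (simp add: eq_neg_iff_add_eq_0)

lemma ev_diff: "ev u v (g - h) = ev u v g - ev u v h"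
  using ev_add[of u v g "- h"] by (simp add: ev_minus)

lemma ev_power: "ev u v (g ^ n) = ev u v g ^ n"
  by (induction n) (simp_all add: ev_mult)

lemma ev_edwards_poly: "ev u v (edwards_poly c) = u\<^sup>2 + v\<^sup>2 - 1 - emb c * u\<^sup>2 * v\<^sup>2"
  using ev_const[of u v c]
  by (simp only: edwards_poly_def ev_add ev_diff ev_mult ev_power ev_var_x ev_var_y ev_1)

lemma ev1_in_subfield: "const_subfield M \<Longrightarrow> u \<in> M \<Longrightarrow> ev1 u q \<in> M"
  by (induction q) (auto simp: ev1_pCons intro: sf_intros)

lemma ev_in_subfield: "const_subfield M \<Longrightarrow> u \<in> M \<Longrightarrow> v \<in> M \<Longrightarrow> ev u v g \<in> M"
  by (induction g) (auto simp: ev_pCons intro: sf_intros ev1_in_subfield)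

lemma generated_eq: "generated {u, v} = {ev u v g / ev u v h | g h. ev u v h \<noteq> 0}" (is "_ = ?N")
proof
  have "const_subfield ?N"
  proof (rule const_subfieldI)
    show "emb a \<in> ?N" for a
      by (rule CollectI, rule exI[of _ "[:[:a:]:]"], rule exI[of _ 1]) (simp add: ev_const)
    fix z w assume "z \<in> ?N" "w \<in> ?N"
    then obtain g h g' h' where *: "z = ev u v g / ev u v h" "ev u v h \<noteq> 0"
      "w = ev u v g' / ev u v h'" "ev u v h' \<noteq> 0" by auto
    then have "z + w = ev u v (g * h' + g' * h) / ev u v (h * h')" "z * w = ev u v (g * g') / ev u v (h * h')"
      "ev u v (h * h') \<noteq> 0" by (auto simp: ev_mult ev_add add_frac_eq)
    then show "z + w \<in> ?N" "z * w \<in> ?N" by blast+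
  next
    fix z assume "z \<in> ?N" "z \<noteq> 0"
    then obtain g h where *: "z = ev u v g / ev u v h" "ev u v h \<noteq> 0" "ev u v g \<noteq> 0" by auto
    then have "inverse z = ev u v h / ev u v g" by simp
    then show "inverse z \<in> ?N" using * by blast
  qed
  moreover have "u \<in> ?N"
    by (rule CollectI, rule exI[of _ var_x], rule exI[of _ 1]) simp
  moreover have "v \<in> ?N"
    by (rule CollectI, rule exI[of _ var_y], rule exI[of _ 1]) simp
  ultimately show "generated {u, v} \<subseteq> ?N" by (intro generated_least) auto
  show "?N \<subseteq> generated {u, v}"
    using const_subfield_generated[of "{u, v}"] generated_incl[of _ "{u, v}"]
    by (auto intro!: sf_divide ev_in_subfield)
qed

text \<open>The description is meaningful once the kernel of evaluation is generated by
  \<open>p\<close>: then the value does not depend on the chosen representation.\<close>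

definition frac_eval :: "'a poly poly \<Rightarrow> 'b \<Rightarrow> 'b \<Rightarrow> 'a ratfun \<Rightarrow> 'b" where
  "frac_eval p u v r = (THE z. \<exists>g h. r = Fract g h \<and> \<not> p dvd h \<and> z = ev u v g / ev u v h)"

text \<open>Evaluation is constant on each coset; this is the shape of the induced map in the
  isomorphism theorem for quotient rings.\<close>

definition curve_eval :: "'a poly poly \<Rightarrow> 'b \<Rightarrow> 'b \<Rightarrow> 'a ratfun set \<Rightarrow> 'b" where
  "curve_eval p u v C = the_elem (frac_eval p u v ` C)"

end

text \<open>As the kernel of a homomorphism into a field, the ideal of \<open>p\<close> is
  automatically prime.\<close>

locale generic_point = constant_embedding emb for emb :: "'a::field \<Rightarrow> 'b::field" +
  fixes p u v
  assumes ker: "ev u v g = 0 \<longleftrightarrow> p dvd g"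
begin

lemma dvd_0_D: "\<not> p dvd h \<Longrightarrow> h \<noteq> 0"
  by auto

lemma frac_eval:
  assumes h: "\<not> p dvd h" shows "frac_eval p u v (Fract g h) = ev u v g / ev u v h"
  unfolding frac_eval_def
proof (rule the_equality)
  fix z assume "\<exists>g' h'. Fract g h = Fract g' h' \<and> \<not> p dvd h' \<and> z = ev u v g' / ev u v h'"
  then obtain g' h' where *: "Fract g h = Fract g' h'" "\<not> p dvd h'" "z = ev u v g' / ev u v h'" by auto
  then have "g * h' = g' * h" using dvd_0_D h eq_fract(1) by blast
  then have "ev u v g * ev u v h' = ev u v g' * ev u v h" by (simp flip: ev_mult)
  then show "z = ev u v g / ev u v h" using * h by (simp add: ker frac_eq_eq)
qed (use h in auto)

lemma prime_like: "\<not> p dvd g \<Longrightarrow> \<not> p dvd h \<Longrightarrow> \<not> p dvd g * h"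
  by (simp add: ev_mult flip: ker)

abbreviation R where "R \<equiv> plane_local_ring p"
abbreviation S where "S \<equiv> (ring_of_type_algebra :: 'b ring)"

lemma ring_R: "ring R"
proof -
  interpret T: ring "ring_of_type_algebra :: 'a ratfun ring" by (rule ring_from_type_algebra)
  have "subring (carrier R) (ring_of_type_algebra :: 'a ratfun ring)"
  proof (rule T.subringI)
    have one: "1 \<in> carrier R"
      using ker[of 1] by (auto simp: plane_local_ring_def One_fract_def)
    then show "\<one>\<^bsub>ring_of_type_algebra :: 'a ratfun ring\<^esub> \<in> carrier R" by (simp add: ring_of_type_algebra_def)
    fix r s assume "r \<in> carrier R" "s \<in> carrier R"
    then obtain g h g' h' where *: "r = Fract g h" "s = Fract g' h'" "\<not> p dvd h" "\<not> p dvd h'"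
      by (auto simp: plane_local_ring_def)
    then have "r + s = Fract (g * h' + g' * h) (h * h')" "r * s = Fract (g * g') (h * h')"
      using dvd_0_D by auto
    then show "r \<oplus>\<^bsub>ring_of_type_algebra\<^esub> s \<in> carrier R" "r \<otimes>\<^bsub>ring_of_type_algebra\<^esub> s \<in> carrier R"
      using * prime_like by (auto simp: plane_local_ring_def ring_of_type_algebra_def)
  next
    fix r assume "r \<in> carrier R"
    then obtain g h where *: "r = Fract g h" "\<not> p dvd h" by (auto simp: plane_local_ring_def)
    have "\<ominus>\<^bsub>ring_of_type_algebra\<^esub> r = - r"
      by (rule T.minus_equality) (auto simp: ring_of_type_algebra_def)
    then show "\<ominus>\<^bsub>ring_of_type_algebra\<^esub> r \<in> carrier R"
      using * by (auto simp: plane_local_ring_def)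
  qed (simp add: ring_of_type_algebra_def)
  then have "ring ((ring_of_type_algebra :: 'a ratfun ring)\<lparr>carrier := carrier R\<rparr>)"
    by (rule T.subring_is_ring)
  then show ?thesis by (simp add: plane_local_ring_def ring_of_type_algebra_def)
qed

lemma frac_eval_hom: "frac_eval p u v \<in> ring_hom R S"
proof (rule ring_hom_memI)
  show "frac_eval p u v \<one>\<^bsub>R\<^esub> = \<one>\<^bsub>S\<^esub>"
    using frac_eval[of 1 1] ker[of 1] by (simp add: plane_local_ring_def ring_of_type_algebra_def One_fract_def)
  fix r s assume "r \<in> carrier R" "s \<in> carrier R"
  then obtain g h g' h' where *: "r = Fract g h" "s = Fract g' h'" "\<not> p dvd h" "\<not> p dvd h'"
    by (auto simp: plane_local_ring_def)
  then have "r + s = Fract (g * h' + g' * h) (h * h')" "r * s = Fract (g * g') (h * h')"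
    using dvd_0_D by auto
  moreover have "ev u v h \<noteq> 0" "ev u v h' \<noteq> 0" using * ker by auto
  ultimately show "frac_eval p u v (r \<oplus>\<^bsub>R\<^esub> s) = frac_eval p u v r \<oplus>\<^bsub>S\<^esub> frac_eval p u v s"
    "frac_eval p u v (r \<otimes>\<^bsub>R\<^esub> s) = frac_eval p u v r \<otimes>\<^bsub>S\<^esub> frac_eval p u v s"
    using * prime_like
    by (auto simp: plane_local_ring_def ring_of_type_algebra_def frac_eval ev_add ev_mult add_frac_eq
        simp del: add_fract mult_fract)
qed (simp add: ring_of_type_algebra_def)

sublocale H: ring_hom_ring R S "frac_eval p u v"
  by (intro ring_hom_ringI2 ring_R ring_from_type_algebra frac_eval_hom)

lemma kernel_eq: "a_kernel R S (frac_eval p u v) = plane_local_ideal p"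
proof -
  have "frac_eval p u v (Fract g h) = 0 \<longleftrightarrow> p dvd g" if "\<not> p dvd h" for g h
    using that by (simp add: frac_eval ker)
  then show ?thesis
    unfolding a_kernel_def' plane_local_ideal_def
    by (auto simp: plane_local_ring_def ring_of_type_algebra_def)
qed

lemma frac_eval_image: "frac_eval p u v ` carrier R = generated {u, v}"
  unfolding generated_eq by (force simp: plane_local_ring_def frac_eval ker)

lemma curve_eval_iso:
  "curve_eval p u v \<in> ring_iso (R Quot plane_local_ideal p) (S\<lparr>carrier := generated {u, v}\<rparr>)"
  using H.FactRing_iso_set_aux unfolding kernel_eq frac_eval_image curve_eval_def[abs_def] .

lemma curve_eval_restrict:
  assumes "\<not> p dvd h"
  shows "curve_eval p u v (restrict_to_curve p (Fract g h)) = ev u v g / ev u v h"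
    and "restrict_to_curve p (Fract g h) \<in> carrier (plane_function_field p)"
proof -
  have c: "Fract g h \<in> carrier R" using assms by (auto simp: plane_local_ring_def)
  show "curve_eval p u v (restrict_to_curve p (Fract g h)) = ev u v g / ev u v h"
    using H.the_elem_simp[OF c] assms by (simp add: kernel_eq curve_eval_def restrict_to_curve_def frac_eval)
  show "restrict_to_curve p (Fract g h) \<in> carrier (plane_function_field p)"
    using c by (auto simp: plane_function_field_def restrict_to_curve_def FactRing_def A_RCOSETS_def'
        ring.extend_def)
qed

lemma field_generated: "field (S\<lparr>carrier := generated {u, v}\<rparr>)"
proof -
  interpret S: field S by (rule field_from_type_algebra)
  note gen = const_subfield_generated[of "{u, v}"]
  have "\<ominus>\<^bsub>S\<^esub> z = - z" for z
    by (rule H.S.minus_equality) (auto simp: ring_of_type_algebra_def)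
  then have sub: "subring (generated {u, v}) S"
    by (intro H.S.subringI) (auto simp: ring_of_type_algebra_def intro: sf_intros[OF gen])
  have "inv\<^bsub>S\<^esub> z = inverse z" if "z \<noteq> 0" for z
    using that by (intro S.comm_inv_char) (auto simp: ring_of_type_algebra_def)
  then have "subfield (generated {u, v}) S"
    using sf_inverse[OF gen] by (intro S.subfieldI' sub) (auto simp: ring_of_type_algebra_def)
  then show ?thesis by (rule H.S.subfield_iff(2))
qed

lemma plane_model: "field_model emb (plane_function_field p) (curve_eval p u v)"
  and plane_model_image: "curve_eval p u v ` carrier (plane_function_field p) = generated {u, v}"
proof -
  define F where "F = plane_function_field p"
  have F: "carrier F = carrier (R Quot plane_local_ideal p)" "monoid.mult F = monoid.mult (R Quot plane_local_ideal p)"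
    "add F = add (R Quot plane_local_ideal p)" "one F = one (R Quot plane_local_ideal p)"
    "zero F = zero (R Quot plane_local_ideal p)" "const F = (\<lambda>a. restrict_to_curve p (Fract [:[:a:]:] 1))"
    by (simp_all add: F_def plane_function_field_def ring.extend_def)
  have iso: "curve_eval p u v \<in> ring_iso F (S\<lparr>carrier := generated {u, v}\<rparr>)"
    using curve_eval_iso by (simp add: ring_iso_def ring_hom_def F)
  let ?Q = "R Quot plane_local_ideal p" and ?S = "S\<lparr>carrier := generated {u, v}\<rparr>"
  have ringQ: "ring ?Q"
    using ideal.quotient_is_ring[OF H.kernel_is_ideal] unfolding kernel_eq .
  interpret S': field ?S by (rule field_generated)
  \<comment> \<open>The quotient is recognized as a field through its copy
    \<open>generated {u, v}\<close>, along the inverse isomorphism.\<close>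
  note sym = ring_iso_set_sym[OF ringQ curve_eval_iso]
  have "inv_into (carrier ?Q) (curve_eval p u v) \<zero>\<^bsub>?S\<^esub> = \<zero>\<^bsub>?Q\<^esub>"
    using ring_hom_zero[OF _ S'.ring_axioms ringQ] sym by (simp only: ring_iso_def mem_Collect_eq)
  then have fieldQ: "field ?Q"
    using S'.ring_iso_imp_img_field[OF sym] by simp
  \<comment> \<open>The function field is the quotient ring with the extra component
    \<open>const\<close>; the identity carries the field axioms to this larger record.\<close>
  have "id \<in> ring_iso ?Q F" by (simp add: ring_iso_def ring_hom_def F ring.ring_simprules[OF ringQ])
  from field.ring_iso_imp_img_field[OF fieldQ this] have fieldF: "field F" by (simp add: F(5)[symmetric])
  show "field_model emb (plane_function_field p) (curve_eval p u v)"
  proof (intro field_model.intro field_model_axioms.intro constant_embedding_axioms)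
    show "field (plane_function_field p)" using fieldF by (simp add: F_def)
    fix a
    have np: "\<not> p dvd 1" using ker[of 1] by simp
    show "const (plane_function_field p) a \<in> carrier (plane_function_field p)"
      using curve_eval_restrict(2)[OF np] F(6) by (simp flip: F_def)
    show "curve_eval p u v (const (plane_function_field p) a) = emb a"
      using curve_eval_restrict(1)[OF np] by (simp add: F(6) ev_const flip: F_def)
  qed (use iso in \<open>auto simp: ring_iso_def ring_hom_def bij_betw_def ring_of_type_algebra_def simp flip: F_def\<close>)
  show "curve_eval p u v ` carrier (plane_function_field p) = generated {u, v}"
    using iso by (auto simp: ring_iso_def bij_betw_def F_def)
qed

end


section \<open>Generic points and the origin of an Edwards curve\<close>

lemma edwards_poly_eq: "edwards_poly c = [:[:-1, 0, 1:], 0, [:1, 0, -c:]:]"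
  by (simp add: edwards_poly_def var_x_def var_y_def power2_eq_square one_pCons)

text \<open>\<open>(1 - c X\<^sup>2) - c (1 - X\<^sup>2)\<close> is the unit \<open>1 - c\<close>, so the leading coefficient of the Edwards
  polynomial is coprime to its constant coefficient.\<close>

lemma edwards_poly_dvd_smult:
  fixes c :: "'a::field"
  assumes c: "c \<noteq> 1" and dvd: "edwards_poly c dvd Polynomial.smult [:1, 0, -c:] g"
  shows "edwards_poly c dvd g"
proof -
  define A B Y :: "'a poly poly" where "A = [:[:1, 0, -c:]:]" and "B = [:[:1, 0, -1:]:]" and "Y = [:0, 0, 1:]"
  have P: "edwards_poly c = A * Y - B" by (simp add: edwards_poly_eq A_def B_def Y_def)
  obtain s where s: "A * g = edwards_poly c * s"
    using dvd unfolding dvd_def by (auto simp: A_def)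
  \<comment> \<open>This is s / A without division: since B s = A (Y s - g), the unit multiple (1 -
    c) s = A s - c B s is visibly divisible by A.\<close>
  define t where "t = [:[:1 / (1 - c):]:] * (s - [:[:c:]:] * (Y * s - g))"
  have AB: "A - [:[:c:]:] * B = [:[:1 - c:]:]" by (simp add: A_def B_def)
  have Bs: "B * s = A * (Y * s - g)" using s by (simp add: P algebra_simps)
  have "A * t = [:[:1 / (1 - c):]:] * (A * s - [:[:c:]:] * (A * (Y * s - g)))"
    by (simp only: t_def mult.left_commute[of A] right_diff_distrib[of A])
  also have "\<dots> = [:[:1 / (1 - c):]:] * ((A - [:[:c:]:] * B) * s)"
    unfolding Bs[symmetric] by (simp only: left_diff_distrib mult.assoc)
  also have "\<dots> = ([:[:1 / (1 - c):]:] * [:[:1 - c:]:]) * s" unfolding AB by (simp only: mult.assoc)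
  also have "[:[:1 / (1 - c):]:] * [:[:1 - c:]:] = 1" using c by (simp add: one_pCons)
  finally have "s = A * t" by simp
  then have "A * g = A * (edwards_poly c * t)" using s by (simp only: mult.left_commute)
  moreover have "A \<noteq> 0" by (simp add: A_def)
  ultimately show ?thesis by (metis mult_left_cancel dvd_triv_left)
qed

text \<open>Compare orders of vanishing at 1: 1 - x^2 has a simple zero there in characteristic
  other than 2, and 1 - c x^2 has none for c \<noteq> 1. So one side has even order and the other
  odd.\<close>

lemma edwards_no_square:
  fixes r0 r1 :: "'a::field poly"
  assumes two: "(2::'a) \<noteq> 0" and c: "c \<noteq> 1"
    and eq: "r0 * r0 * [:1, 0, -c:] = r1 * r1 * [:1, 0, -1:]"
  shows "r0 = 0 \<and> r1 = 0"
proof (rule ccontr)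
  assume n: "\<not> (r0 = 0 \<and> r1 = 0)"
  define A B where "A = [:1, 0, -c:]" and "B = [:1, 0, -1::'a:]"
  have eq': "r0 * r0 * A = r1 * r1 * B" using eq by (simp only: A_def B_def)
  have "A \<noteq> 0" "B \<noteq> 0" by (auto simp: A_def B_def)
  then have r: "r0 \<noteq> 0" "r1 \<noteq> 0" using eq' n by auto
  have "B = [:-1, 1:] * [:-1, -1:]" by (simp add: B_def)
  moreover have "poly [:-1, -1::'a:] 1 \<noteq> 0" using two by simp
  then have "Polynomial.order 1 [:-1, -1::'a:] = 0" by (rule order_0I)
  moreover have "Polynomial.order 1 [:-1, 1::'a:] = 1" using order_power_n_n[of "1::'a" 1] by simp
  ultimately have oB: "Polynomial.order 1 B = 1"
    using order_mult[of "[:-1, 1:]" "[:-1, -1::'a:]" 1] \<open>B \<noteq> 0\<close> by simp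
  have oA: "Polynomial.order 1 A = 0" using c by (intro order_0I) (simp add: A_def)
  have "2 * Polynomial.order 1 r0 = 2 * Polynomial.order 1 r1 + 1"
    using arg_cong[OF eq', of "Polynomial.order 1"] r \<open>A \<noteq> 0\<close> \<open>B \<noteq> 0\<close> by (simp add: order_mult oA oB)
  then show False by presburger
qed

section \<open>Generic points over algebraically closed constants\<close>

locale acl_constant_embedding = constant_embedding emb
  for emb :: "'a::alg_closed_field \<Rightarrow> 'b::field"
begin

text \<open>A nonconstant element is transcendental: polynomials split into linear factors, and no
  factor u - a vanishes.\<close>

lemma ev1_eq_0_iff:
  assumes u: "u \<notin> range emb" shows "ev1 u q = 0 \<longleftrightarrow> q = 0"
proof (induction "degree q" arbitrary: q rule: less_induct)
  case less
  show ?case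
  proof (cases "degree q = 0")
    case True
    then obtain a where "q = [:a:]" by (rule degree_eq_zeroE)
    then show ?thesis by (simp add: ev1_pCons)
  next
    case False
    then obtain a where "poly q a = 0" using alg_closed_imp_poly_has_root by blast
    then obtain r where r: "q = [:-a, 1:] * r" by (auto simp: poly_eq_0_iff_dvd elim: dvdE)
    then have r0: "r \<noteq> 0" using False by auto
    then have "degree r < degree q" by (simp add: r degree_mult_eq del: mult_pCons_left)
    then have "ev1 u r \<noteq> 0" using less r0 by blast
    moreover have "ev1 u q = (u - emb a) * ev1 u r"
      by (simp add: r ev1_mult ev1_pCons emb_minus del: mult_pCons_left)
    ultimately show ?thesis using u False by auto
  qed
qed

text \<open>Modulo the Edwards polynomial, g reduces to r0 + r1 y. Its vanishing at (u, v) gives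
  r0^2 (1 - c x^2) = r1^2 (1 - x^2), first at u and then, u being transcendental, as polynomials,
  which forces r0 = r1 = 0.\<close>

lemma edwards_generic_point:
  assumes two: "(2::'a) \<noteq> 0" and c: "c \<noteq> 1" and u: "u \<notin> range emb"
    and eq: "u\<^sup>2 + v\<^sup>2 = 1 + emb c * u\<^sup>2 * v\<^sup>2"
  shows "generic_point emb (edwards_poly c) u v"
proof unfold_locales
  fix g
  have P0: "ev u v (edwards_poly c) = 0" using eq by (simp add: ev_edwards_poly)
  show "ev u v g = 0 \<longleftrightarrow> edwards_poly c dvd g"
  proof
    assume g: "ev u v g = 0"
    define A :: "'a poly" where "A = [:1, 0, -c:]"
    have deg: "degree (edwards_poly c) = 2" and lead: "coeff (edwards_poly c) 2 = A"
      by (simp_all add: edwards_poly_eq A_def numeral_2_eq_2)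
    have ne: "edwards_poly c \<noteq> 0" using deg by auto
    \<comment> \<open>The leading coefficient A in y is not a unit, so division only describes a
      multiple A^k g; the power is cancelled at the end.\<close>
    obtain q r where qr: "pseudo_divmod g (edwards_poly c) = (q, r)" by fastforce
    define k where "k = Suc (degree g) - degree (edwards_poly c)"
    have eqn: "Polynomial.smult (A ^ k) g = edwards_poly c * q + r" and "r = 0 \<or> degree r < 2"
      using pseudo_divmod[OF ne qr] by (simp_all add: deg lead k_def)
    then have "degree r < 2" by auto
    define r0 r1 where "r0 = coeff r 0" and "r1 = coeff r 1"
    have r: "r = [:r0, r1:]"
      using \<open>degree r < 2\<close>
      by (intro poly_eqI) (auto simp: r0_def r1_def coeff_pCons coeff_eq_0 split: nat.splits)
    have "ev u v (Polynomial.smult (A ^ k) g) = 0"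
      using ev_mult[of u v "[:A ^ k:]" g] g by simp
    then have "ev u v r = 0" by (simp add: eqn ev_add ev_mult P0)
    then have r01: "ev1 u r0 = - (v * ev1 u r1)" by (simp add: r ev_pCons eq_neg_iff_add_eq_0)
    have A: "ev1 u A = 1 - emb c * u\<^sup>2" and B: "ev1 u [:1, 0, -1:] = 1 - u\<^sup>2"
      by (simp_all add: A_def ev1_pCons emb_minus power2_eq_square)
    have vA: "v\<^sup>2 * (1 - emb c * u\<^sup>2) = 1 - u\<^sup>2" using eq by (simp add: algebra_simps)
    have "ev1 u (r0 * r0 * A) = (v * ev1 u r1)\<^sup>2 * (1 - emb c * u\<^sup>2)"
      by (simp add: ev1_mult r01 A power2_eq_square)
    also have "\<dots> = (ev1 u r1)\<^sup>2 * (v\<^sup>2 * (1 - emb c * u\<^sup>2))" by (simp add: power_mult_distrib)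
    also have "\<dots> = ev1 u (r1 * r1 * [:1, 0, -1:])"
      unfolding vA by (simp only: ev1_mult B power2_eq_square)
    finally have "ev1 u (r0 * r0 * A + [:-1:] * (r1 * r1 * [:1, 0, -1:])) = 0"
      by (simp only: ev1_add ev1_mult) (simp add: ev1_pCons emb_minus)
    then have "r0 * r0 * A + [:-1:] * (r1 * r1 * [:1, 0, -1:]) = 0" by (simp only: ev1_eq_0_iff[OF u])
    then have "r0 * r0 * A = r1 * r1 * [:1, 0, -1:]"
      by (simp add: add_eq_0_iff2)
    then have "r0 = 0 \<and> r1 = 0" unfolding A_def by (rule edwards_no_square[OF two c])
    then have dvd: "edwards_poly c dvd Polynomial.smult (A ^ k) g"
      by (simp add: r eqn)
    have step: "edwards_poly c dvd h" if "edwards_poly c dvd Polynomial.smult A h" for h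
      using edwards_poly_dvd_smult[OF c, of h] that by (simp only: A_def)
    from dvd show "edwards_poly c dvd g"
    proof (induction k)
      case (Suc k)
      have "edwards_poly c dvd Polynomial.smult A (Polynomial.smult (A ^ k) g)"
        using Suc.prems(1) by (simp only: power_Suc smult_smult)
      then show ?case by (rule Suc.IH[OF step])
    qed simp
  qed (auto simp: dvd_def ev_mult P0)
qed

end

context generic_point
begin

lemma edwards_coords_iff:
  assumes p: "p = edwards_poly c" and P: "P \<in> places (edwards_field c)"
  shows "edwards_coords c P a b \<longleftrightarrow>
    val_at (curve_eval p u v ` P) u a \<and> val_at (curve_eval p u v ` P) v b"
proof -
  interpret M: field_model emb "plane_function_field p" "curve_eval p u v" by (rule plane_model)
  have np: "\<not> p dvd 1" using ker[of 1] by simp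
  note c = M.places_carrier[OF P[unfolded edwards_field_def, folded p]]
  show ?thesis
    unfolding edwards_coords_def edwards_field_def p[symmetric]
    using M.has_value_iff[OF c curve_eval_restrict(2)[OF np]] curve_eval_restrict(1)[OF np] by simp
qed

end

context constant_embedding
begin

lemma val_at_ev:
  assumes L: "const_subfield L" "val_ring L V" and u: "val_at V u a" and v: "val_at V v b"
  shows "val_at V (ev u v g) (poly (poly g [:b:]) a)"
proof (induction g)
  case (pCons q g)
  have "val_at V (ev1 u q) (poly q a)" for q
    by (induction q) (auto simp: ev1_pCons intro!: val_at_intros[OF L] u val_at_const[OF L, of 0, simplified])
  then show ?case using pCons(2) by (auto simp: ev_pCons intro!: val_at_intros[OF L] v)
qed (use val_at_const[OF L, of 0] in simp)

end

section \<open>Expansion of an Edwards curve in Laurent series\<close>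

fun sqrt_coeff :: "(nat \<Rightarrow> 'a::field) \<Rightarrow> nat \<Rightarrow> 'a" where
  "sqrt_coeff a 0 = 1"
| "sqrt_coeff a (Suc n) = (a (Suc n) - (\<Sum>i=1..n. sqrt_coeff a i * sqrt_coeff a (Suc n - i))) / 2"

text \<open>With constant term 1, the coefficient of index n + 1 in s * s is twice that of s plus
  products of earlier ones, so a recursion that divides only by 2 determines s.\<close>

lemma fps_sqrt_exists:
  fixes a :: "'a::field fps"
  assumes two: "(2::'a) \<noteq> 0" and a: "fps_nth a 0 = 1"
  shows "\<exists>s. s * s = a \<and> fps_nth s 0 = 1"
proof -
  define b where "b = sqrt_coeff (fps_nth a)"
  have "fps_nth (Abs_fps b * Abs_fps b) n = fps_nth a n" for n
  proof (cases n)
    case (Suc m)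
    have "fps_nth (Abs_fps b * Abs_fps b) (Suc m) = (\<Sum>i=0..Suc m. b i * b (Suc m - i))"
      by (simp add: fps_mult_nth)
    also have "\<dots> = b 0 * b (Suc m) + ((\<Sum>i=1..m. b i * b (Suc m - i)) + b (Suc m) * b 0)"
      by (simp add: sum.atLeast_Suc_atMost)
    also have "\<dots> = 2 * b (Suc m) + (\<Sum>i=1..m. b i * b (Suc m - i))"
      by (simp add: b_def)
    also have "2 * b (Suc m) = fps_nth a (Suc m) - (\<Sum>i=1..m. b i * b (Suc m - i))"
      using two by (simp add: b_def)
    finally show ?thesis by (simp add: Suc)
  qed (simp add: b_def a)
  then have "Abs_fps b * Abs_fps b = a" by (intro fps_ext)
  moreover have "fps_nth (Abs_fps b) 0 = 1" by (simp add: b_def)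
  ultimately show ?thesis by blast
qed

interpretation fls: constant_embedding "fls_const :: 'a::field \<Rightarrow> 'a fls"
  by unfold_locales (simp_all add: fls_plus_const)

text \<open>Zero is included because \<open>fls_subdegree 0 = 0\<close>.\<close>

definition integral_part :: "'a::field fls set \<Rightarrow> 'a fls set" where
  "integral_part L = {f \<in> L. 0 \<le> fls_subdegree f}"

lemma integral_iff: "0 \<le> fls_subdegree f \<longleftrightarrow> f \<in> range fps_to_fls"
  by (metis fls_regpart_to_fls_trivial fls_subdegree_fls_to_fps_gt0 image_iff rangeI)

lemma fls_val_ring:
  assumes L: "fls.const_subfield L" "fls_X \<in> L"
  shows "fls.val_ring L (integral_part L)"
proof -
  have "integral_part L \<noteq> L"
    using fls.sf_inverse[OF L] by (force simp: integral_part_def)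
  moreover have "z + w \<in> integral_part L" "z * w \<in> integral_part L"
    if "z \<in> integral_part L" "w \<in> integral_part L" for z w
    using that fls.sf_add[OF L(1)] fls.sf_mult[OF L(1)]
    by (auto simp: integral_part_def integral_iff simp flip: fps_to_fls_plus fls_times_fps_to_fls)
  ultimately show ?thesis
    unfolding fls.val_ring_def
    using fls.sf_const[OF L(1)] fls.sf_inverse[OF L(1)] by (auto simp: integral_part_def)
qed

lemma fls_max_idealI:
  assumes "f \<in> L" "0 < fls_subdegree f" shows "f \<in> fls.max_ideal (integral_part L)"
  using assms by (auto simp: fls.max_ideal_def integral_part_def fls_inverse_subdegree)

text \<open>\<open>y1\<close> selects the branch through (0, 1) rather than (0, -1). The alternative
  y = 1 is listed because the zero series has subdegree 0 by convention.\<close>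

locale edwards_series =
  fixes c :: "'a::alg_closed_field" and y :: "'a fls"
  assumes two: "(2::'a) \<noteq> 0" and c: "c \<noteq> 1"
    and curve: "fls_X\<^sup>2 + y\<^sup>2 = 1 + fls_const c * fls_X\<^sup>2 * y\<^sup>2"
    and y1: "0 < fls_subdegree (y - 1) \<or> y = 1"

lemma edwards_series_exists:
  fixes c :: "'a::alg_closed_field"
  assumes two: "(2::'a) \<noteq> 0" and c: "c \<noteq> 1"
  shows "\<exists>y. edwards_series c y"
proof -
  define a where "a = (1 - fps_X\<^sup>2) * inverse (1 - fps_const c * fps_X\<^sup>2)"
  have u: "fps_nth (1 - fps_const c * fps_X\<^sup>2) 0 = 1" by (simp add: power2_eq_square)
  have "fps_nth a 0 = 1" using u by (simp add: a_def power2_eq_square)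
  then obtain s where s: "s * s = a" "fps_nth s 0 = 1" using fps_sqrt_exists[OF two] by blast
  have "a * (1 - fps_const c * fps_X\<^sup>2) = 1 - fps_X\<^sup>2"
    using u inverse_mult_eq_1[of "1 - fps_const c * fps_X\<^sup>2"] by (simp add: a_def mult.assoc)
  then have "fps_X\<^sup>2 + s\<^sup>2 = 1 + fps_const c * fps_X\<^sup>2 * s\<^sup>2"
    by (simp add: power2_eq_square algebra_simps flip: s)
  then have "fps_to_fls (fps_X\<^sup>2 + s\<^sup>2) = fps_to_fls (1 + fps_const c * fps_X\<^sup>2 * s\<^sup>2)" by simp
  then have "fls_X\<^sup>2 + (fps_to_fls s)\<^sup>2 = 1 + fls_const c * fls_X\<^sup>2 * (fps_to_fls s)\<^sup>2"
    by (simp add: fls_times_fps_to_fls fps_to_fls_power)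
  moreover have "0 < fls_subdegree (fps_to_fls s - 1) \<or> fps_to_fls s = 1"
  proof (cases "s = 1")
    case False
    then have "subdegree (s - 1) \<noteq> 0" using s(2) by (simp add: subdegree_eq_0_iff)
    then show ?thesis
      using fls_subdegree_fls_to_fps[of "s - 1"] by simp
  qed simp
  ultimately show ?thesis using two c by (auto simp: edwards_series_def)
qed

interpretation fls: acl_constant_embedding "fls_const :: 'a::alg_closed_field \<Rightarrow> 'a fls"
  by unfold_locales

section \<open>The place over (0, 1), with uniformizer x\<close>

context edwards_series
begin

abbreviation L where "L \<equiv> fls.generated {fls_X, y}"

sublocale generic_point fls_const "edwards_poly c" fls_X y
proof (rule fls.edwards_generic_point[OF two c _ curve])
  show "fls_X \<notin> range (fls_const :: 'a \<Rightarrow> 'a fls)"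
    using fls_X_subdegree fls_const_subdegree by (metis imageE zero_neq_one)
qed

lemma subfield_L: "fls.const_subfield L"
  by (rule fls.const_subfield_generated)

lemma X_in_L: "fls_X \<in> L" and y_in_L: "y \<in> L"
  by (auto intro: fls.generated_incl)

definition at_origin :: "'a fls set \<Rightarrow> bool" where
  "at_origin V \<longleftrightarrow> fls.val_ring L V \<and> fls.val_at V fls_X 0 \<and> fls.val_at V y 1"

lemma at_origin_integral: "at_origin (integral_part L)"
proof -
  note V = fls_val_ring[OF subfield_L X_in_L]
  have "y - 1 \<in> fls.max_ideal (integral_part L)"
  proof (cases "y = 1")
    case False
    then show ?thesis
      using y1 fls.sf_diff[OF subfield_L y_in_L fls.sf_1[OF subfield_L]] by (intro fls_max_idealI) auto
  next
    case True
    then have "y - 1 = 0" by simp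
    then show ?thesis using fls.mi_0[OF subfield_L V] by (simp only:)
  qed
  then show ?thesis
    using V X_in_L by (auto simp: at_origin_def fls.val_at_def intro: fls_max_idealI)
qed

lemma subdegree_val:
  assumes "fls.val_at (integral_part L) f a" "a \<noteq> 0" shows "fls_subdegree f = 0"
proof -
  note V = fls_val_ring[OF subfield_L X_in_L]
  have "f \<in> integral_part L" using fls.val_at_sub[OF subfield_L V assms(1)] .
  moreover have "inverse f \<in> integral_part L" using fls.val_at_nonzero[OF subfield_L V assms] by simp
  ultimately show ?thesis by (simp add: integral_part_def)
qed

lemma poly_at_origin:
  assumes "at_origin V" shows "fls.val_at V (fls.ev fls_X y g) (poly (poly g 1) 0)"
  using fls.val_at_ev[OF subfield_L, of V fls_X 0 y 1 g] assms by (simp add: at_origin_def one_pCons)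

lemma one_plus_y_at_origin: "at_origin V \<Longrightarrow> fls.val_at V (1 + y) 2"
  using fls.val_at_add[OF subfield_L, of V 1 1 y 1] fls.val_at_1[OF subfield_L, of V]
  by (simp add: at_origin_def)

text \<open>If \<open>g(0, 1) = 0\<close>, then \<open>g = (Y - 1) g\<^sub>2 + X q\<close>, and \<open>y\<^sup>2 - 1\<close> is divisible by \<open>x\<close>.\<close>

lemma divide_by_X:
  assumes "poly (poly g 1) 0 = 0"
  shows "\<exists>g'. (1 + y) * fls.ev fls_X y g = fls_X * fls.ev fls_X y g'"
proof -
  obtain q where q: "poly g 1 = pCons 0 q"
    using assms by (cases "poly g 1") auto
  define g2 where "g2 = synthetic_div g 1"
  have g: "g = [:-1, 1:] * g2 + [:poly g 1:]"
    using synthetic_div_correct'[of 1 g] by (simp add: g2_def)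
  have "fls.ev fls_X y g = fls.ev fls_X y [:-1, 1:] * fls.ev fls_X y g2 + fls.ev fls_X y [:pCons 0 q:]"
    by (subst g) (simp only: fls.ev_add fls.ev_mult q)
  moreover have "fls.ev fls_X y [:-1, 1:] = y - 1"
    using fls.ev1_1 fls.ev_minus[of fls_X y 1] by (simp add: fls.ev_pCons) (simp add: one_pCons fls.ev_pCons)
  moreover have "fls.ev fls_X y [:pCons 0 q:] = fls_X * fls.ev1 fls_X q"
    by (simp add: fls.ev_pCons fls.ev1_pCons)
  ultimately have e: "fls.ev fls_X y g = (y - 1) * fls.ev fls_X y g2 + fls_X * fls.ev1 fls_X q" by simp
  \<comment> \<open>Multiplying by 1 + y turns y - 1 into y^2 - 1 = x^2 (c y^2 - 1); one factor x is
    split off from this and from the second summand x q.\<close>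
  define g' where "g' = var_x * ([:[:c:]:] * var_y\<^sup>2 - 1) * g2 + (1 + var_y) * [:q:]"
  have g': "fls.ev fls_X y g' = fls_X * (fls_const c * y\<^sup>2 - 1) * fls.ev fls_X y g2 + (1 + y) * fls.ev1 fls_X q"
    using fls.ev_const[of fls_X y c]
    by (simp only: g'_def fls.ev_add fls.ev_mult fls.ev_diff fls.ev_power fls.ev_var_x fls.ev_var_y fls.ev_1)
      (simp add: fls.ev_pCons)
  have "y\<^sup>2 - 1 = fls_X\<^sup>2 * (fls_const c * y\<^sup>2 - 1)" using curve by (simp add: algebra_simps)
  then have "(1 + y) * (y - 1) = fls_X * (fls_X * (fls_const c * y\<^sup>2 - 1))"
    by (simp add: algebra_simps power2_eq_square)
  then have "(1 + y) * (y - 1) * fls.ev fls_X y g2 = fls_X * (fls_X * (fls_const c * y\<^sup>2 - 1)) * fls.ev fls_X y g2"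
    by simp
  then have "(1 + y) * fls.ev fls_X y g = fls_X * fls.ev fls_X y g'"
    unfolding e g' by (simp only: distrib_left mult.assoc mult.left_commute)
  then show ?thesis by blast
qed

text \<open>Repeated division by x stops because each round lowers the order of the Laurent series
  by one: 1 + y has value 2 at the origin, hence order 0.\<close>

lemma poly_decomposition:
  assumes "fls.ev fls_X y g \<noteq> 0"
  shows "\<exists>n g'. (1 + y) ^ n * fls.ev fls_X y g = fls_X ^ n * fls.ev fls_X y g' \<and> poly (poly g' 1) 0 \<noteq> 0"
  using assms
proof (induction "nat (fls_subdegree (fls.ev fls_X y g))" arbitrary: g rule: less_induct)
  case less
  show ?case
  proof (cases "poly (poly g 1) 0 = 0")
    case False
    then show ?thesis by (intro exI[of _ 0] exI[of _ g]) simp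
  next
    case True
    then obtain g1 where g1: "(1 + y) * fls.ev fls_X y g = fls_X * fls.ev fls_X y g1"
      using divide_by_X by blast
    have sub: "0 \<le> fls_subdegree (fls.ev fls_X y g1)"
      using fls.val_at_sub[OF subfield_L _ poly_at_origin[OF at_origin_integral]] at_origin_integral
      by (auto simp: at_origin_def integral_part_def)
    have y0: "fls_subdegree (1 + y) = 0"
      using subdegree_val[OF one_plus_y_at_origin[OF at_origin_integral] two] .
    have "fls.val_at (integral_part L) (1 + y) 2" by (rule one_plus_y_at_origin[OF at_origin_integral])
    then have y1: "1 + y \<noteq> 0"
      using fls.val_at_nonzero[OF subfield_L _ _ two] at_origin_integral by (auto simp: at_origin_def)
    then have g1_nz: "fls.ev fls_X y g1 \<noteq> 0" using g1 less.prems by auto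
    have "fls_subdegree (fls.ev fls_X y g) = 1 + fls_subdegree (fls.ev fls_X y g1)"
      using arg_cong[OF g1, of fls_subdegree] y1 g1_nz less.prems by (simp add: y0)
    then obtain n g' where IH: "(1 + y) ^ n * fls.ev fls_X y g1 = fls_X ^ n * fls.ev fls_X y g'"
      "poly (poly g' 1) 0 \<noteq> 0" using less.hyps[of g1] g1_nz sub by auto
    have "(1 + y) ^ Suc n * fls.ev fls_X y g = (1 + y) ^ n * (fls_X * fls.ev fls_X y g1)"
      by (simp add: mult.assoc mult.left_commute flip: g1)
    also have "\<dots> = fls_X ^ Suc n * fls.ev fls_X y g'"
      using IH(1) by (simp add: mult.left_commute)
    finally show ?thesis using IH(2) by blast
  qed
qed

text \<open>x is a uniformizer at (0, 1), and the unit t works for every place there at once. The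
  exponent is written as a quotient of two powers since it may be negative.\<close>

lemma decomposition:
  assumes f: "f \<in> L" "f \<noteq> 0"
  shows "\<exists>n m t. f = fls_X ^ n / fls_X ^ m * t \<and> (\<forall>V. at_origin V \<longrightarrow> t \<in> V \<and> inverse t \<in> V)"
proof -
  obtain g h where gh: "f = fls.ev fls_X y g / fls.ev fls_X y h" "fls.ev fls_X y h \<noteq> 0"
    using f(1) unfolding fls.generated_eq by blast
  then have g: "fls.ev fls_X y g \<noteq> 0" using f(2) by auto
  obtain n g' where n: "(1 + y) ^ n * fls.ev fls_X y g = fls_X ^ n * fls.ev fls_X y g'"
    "poly (poly g' 1) 0 \<noteq> 0" using poly_decomposition[OF g] by blast
  obtain m h' where m: "(1 + y) ^ m * fls.ev fls_X y h = fls_X ^ m * fls.ev fls_X y h'"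
    "poly (poly h' 1) 0 \<noteq> 0" using poly_decomposition[OF gh(2)] by blast
  \<comment> \<open>The powers of 1 + y and the parts of numerator and denominator not vanishing at
    (0, 1) are collected in t, so its value there is a nonzero constant.\<close>
  define t where "t = ((1 + y) ^ m * fls.ev fls_X y g') / ((1 + y) ^ n * fls.ev fls_X y h')"
  have unit: "t \<in> V \<and> inverse t \<in> V" if V: "at_origin V" for V
  proof -
    have V': "fls.val_ring L V" using V by (simp add: at_origin_def)
    have "fls.val_at V t ((2 ^ m * poly (poly g' 1) 0) / (2 ^ n * poly (poly h' 1) 0))"
      unfolding t_def using n(2) m(2) two
      by (intro fls.val_at_intros[OF subfield_L V'] poly_at_origin V one_plus_y_at_origin) auto
    moreover have "(2 ^ m * poly (poly g' 1) 0) / (2 ^ n * poly (poly h' 1) 0) \<noteq> 0"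
      using n(2) m(2) two by simp
    ultimately show ?thesis
      using fls.val_at_sub[OF subfield_L V'] fls.val_at_nonzero[OF subfield_L V'] by blast
  qed
  have "1 + y \<noteq> 0"
    using fls.val_at_nonzero[OF subfield_L _ one_plus_y_at_origin[OF at_origin_integral] two]
      at_origin_integral by (auto simp: at_origin_def)
  then have "fls.ev fls_X y g = fls_X ^ n * fls.ev fls_X y g' / (1 + y) ^ n"
    "fls.ev fls_X y h = fls_X ^ m * fls.ev fls_X y h' / (1 + y) ^ m"
    using n(1) m(1) by (simp_all add: nonzero_eq_divide_eq mult.commute)
  moreover have "(A * B / C) / (A' * B' / C') = A / A' * ((C' * B) / (C * B'))" for A B C A' B' C' :: "'a fls"
    by (simp add: mult_ac)
  ultimately have "f = fls_X ^ n / fls_X ^ m * t"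
    unfolding gh(1) t_def by (simp only:)
  then show ?thesis using unit by blast
qed

text \<open>An f in \<open>V\<close> cannot involve a negative power of x, as x is in the maximal
  ideal of \<open>V\<close>. Thus f is x^(n - m) times a unit common to all places over (0, 1), and
  lies in \<open>W\<close>.\<close>

lemma at_origin_unique:
  assumes V: "at_origin V" and W: "at_origin W" shows "V \<subseteq> W"
proof
  fix f assume f: "f \<in> V"
  have V': "fls.val_ring L V" and W': "fls.val_ring L W" using V W by (auto simp: at_origin_def)
  show "f \<in> W"
  proof (cases "f = 0")
    case False
    then obtain n m t where t: "f = fls_X ^ n / fls_X ^ m * t"
      "\<And>V. at_origin V \<Longrightarrow> t \<in> V \<and> inverse t \<in> V"
      using decomposition[of f] fls.vr_sub[OF subfield_L V' f] by blast
    have X: "fls_X \<in> fls.max_ideal V" using V by (simp add: at_origin_def fls.val_at_def)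
    have "m \<le> n"
    proof (rule ccontr)
      assume "\<not> m \<le> n"
      then obtain k where "m = n + Suc k" by (metis less_imp_Suc_add not_le add_Suc_right)
      then have "f * fls_X ^ Suc k = t" by (simp add: t(1) power_add)
      then have "f * fls_X ^ k * fls_X = t" by (simp only: power_Suc2 mult.assoc)
      moreover have "t \<noteq> 0" using t(1) False by auto
      ultimately have "f * fls_X ^ k * fls_X * inverse t = 1" by simp
      moreover have "inverse t * (f * fls_X ^ k) * fls_X \<in> fls.max_ideal V"
        using X f t(2)[OF V] fls.mi_sub[OF X]
        by (intro fls.mi_mult[OF subfield_L V'] fls.vr_mult[OF subfield_L V'] fls.vr_power[OF subfield_L V']) auto
      ultimately show False using fls.mi_one[OF subfield_L V'] by (simp add: mult_ac)
    qed
    then have "f = fls_X ^ (n - m) * t" by (simp add: t(1) power_diff)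
    then show ?thesis
      using t(2)[OF W] fls.val_at_sub[OF subfield_L W', of fls_X 0] W
      by (auto simp: at_origin_def intro!: fls.vr_mult[OF subfield_L W'] fls.vr_power[OF subfield_L W'])
  qed (use fls.vr_0[OF subfield_L W'] in simp)
qed

sublocale E: field_model fls_const "edwards_field c" "fls.curve_eval (edwards_poly c) fls_X y"
  using plane_model by (simp add: edwards_field_def)

lemma E_image: "fls.curve_eval (edwards_poly c) fls_X y ` carrier (edwards_field c) = L"
  using plane_model_image by (simp add: edwards_field_def)

lemma coords_origin_iff:
  "P \<in> places (edwards_field c) \<and> edwards_coords c P 0 1 \<longleftrightarrow>
     P \<in> places (edwards_field c) \<and> at_origin (fls.curve_eval (edwards_poly c) fls_X y ` P)"
  using edwards_coords_iff[OF refl, of P 0 1] E.places_val_ring[of P] E_image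
  by (auto simp: at_origin_def)

text \<open>This gives \<open>edwards_origin\<close> its meaning: existence comes from the order in
  the Laurent series, uniqueness from the uniformizer.\<close>

lemma origin_ex1: "\<exists>!P. P \<in> places (edwards_field c) \<and> edwards_coords c P 0 1"
proof (rule ex_ex1I)
  have V: "fls.val_ring (fls.curve_eval (edwards_poly c) fls_X y ` carrier (edwards_field c)) (integral_part L)"
    using fls_val_ring[OF subfield_L X_in_L] by (simp add: E_image)
  show "\<exists>P. P \<in> places (edwards_field c) \<and> edwards_coords c P 0 1"
    unfolding coords_origin_iff
    by (rule exI, rule conjI, rule E.val_ring_places(1)[OF V])
      (simp only: E.val_ring_places(2)[OF V] at_origin_integral)
next
  fix P Q assume PQ: "P \<in> places (edwards_field c) \<and> edwards_coords c P 0 1"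
    "Q \<in> places (edwards_field c) \<and> edwards_coords c Q 0 1"
  then have "fls.curve_eval (edwards_poly c) fls_X y ` P = fls.curve_eval (edwards_poly c) fls_X y ` Q"
    unfolding coords_origin_iff by (intro subset_antisym at_origin_unique) simp_all
  then show "P = Q"
    using inj_on_image_eq_iff[OF E.\<psi>_inj, of P Q] E.places_carrier[of P] E.places_carrier[of Q] PQ
    by simp
qed

lemma origin: "edwards_origin c \<in> places (edwards_field c)" "edwards_coords c (edwards_origin c) 0 1"
  using theI'[OF origin_ex1] by (auto simp: edwards_origin_def)

lemma origin_eqI: "P \<in> places (edwards_field c) \<Longrightarrow> edwards_coords c P 0 1 \<Longrightarrow> P = edwards_origin c"
  using origin_ex1 origin by blast

end


section \<open>Isogenies of degree two\<close>

text \<open>Both subfields are copies of the same function field; \<sigma> leads back from the first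
  copy and out to the second. Negating a generic point thus yields the involution of
  \<open>L\<close>.\<close>

lemma (in constant_embedding) generic_points_conjugate:
  assumes gen: "generic_point emb p u v" and gen': "generic_point emb p u' v'"
  shows "\<exists>\<sigma>. (\<forall>z\<in>generated {u, v}. \<sigma> z \<in> generated {u', v'}) \<and>
    (\<forall>z\<in>generated {u, v}. \<forall>w\<in>generated {u, v}. \<sigma> (z + w) = \<sigma> z + \<sigma> w \<and> \<sigma> (z * w) = \<sigma> z * \<sigma> w) \<and>
    (\<forall>a. \<sigma> (emb a) = emb a) \<and> \<sigma> u = u' \<and> \<sigma> v = v'"
proof -
  let ?F = "plane_function_field p"
  interpret A: generic_point emb p u v by (rule gen)
  interpret B: generic_point emb p u' v' by (rule gen')
  interpret F: field_model emb ?F "curve_eval p u v" by (rule A.plane_model)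
  interpret G: field_model emb ?F "curve_eval p u' v'" by (rule B.plane_model)
  define j where "j = inv_into (carrier ?F) (curve_eval p u v)"
  define \<sigma> where "\<sigma> z = curve_eval p u' v' (j z)" for z
  have np: "\<not> p dvd 1" using A.ker[of 1] by simp
  have j: "j z \<in> carrier ?F" "curve_eval p u v (j z) = z" if "z \<in> generated {u, v}" for z
    using that inv_into_into[of z "curve_eval p u v" "carrier ?F"]
    by (auto simp: j_def A.plane_model_image f_inv_into_f)
  have j_eqI: "j (curve_eval p u v f) = f" if "f \<in> carrier ?F" for f
    using that F.\<psi>_inj by (simp add: j_def)
  have hom: "\<sigma> (z + w) = \<sigma> z + \<sigma> w" "\<sigma> (z * w) = \<sigma> z * \<sigma> w"
    if "z \<in> generated {u, v}" "w \<in> generated {u, v}" for z w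
  proof -
    note zw = j[OF that(1)] j[OF that(2)]
    have "j (z + w) = j z \<oplus>\<^bsub>?F\<^esub> j w" "j (z * w) = j z \<otimes>\<^bsub>?F\<^esub> j w"
      using zw j_eqI[of "j z \<oplus>\<^bsub>?F\<^esub> j w"] j_eqI[of "j z \<otimes>\<^bsub>?F\<^esub> j w"]
      by (simp_all add: F.\<psi>_add F.\<psi>_mult)
    then show "\<sigma> (z + w) = \<sigma> z + \<sigma> w" "\<sigma> (z * w) = \<sigma> z * \<sigma> w"
      using zw by (simp_all add: \<sigma>_def G.\<psi>_add G.\<psi>_mult)
  qed
  have ev: "\<sigma> (ev u v g) = ev u' v' g" for g
    using A.curve_eval_restrict[OF np, of g] B.curve_eval_restrict(1)[OF np, of g] j_eqI
    by (metis \<sigma>_def ev_1 div_by_1)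
  have "\<sigma> (emb a) = emb a" for a using ev[of "[:[:a:]:]"] by (simp add: ev_const)
  moreover have "\<sigma> u = u'" "\<sigma> v = v'" using ev[of var_x] ev[of var_y] by simp_all
  moreover have "\<sigma> z \<in> generated {u', v'}" if "z \<in> generated {u, v}" for z
    using j[OF that] by (auto simp: \<sigma>_def simp flip: B.plane_model_image)
  ultimately show ?thesis using hom by blast
qed

context edwards_series
begin

lemma val_at_origin_nonzero:
  assumes "fls.val_at (integral_part L) f k" "k \<noteq> 0" shows "f \<noteq> 0"
  using fls.val_at_nonzero[OF subfield_L _ assms] at_origin_integral by (auto simp: at_origin_def)

lemma one_minus_nonzero: "1 - fls_const (k :: 'a) * fls_X\<^sup>2 \<noteq> 0"
proof -
  have V0: "fls.val_ring L (integral_part L)" "fls.val_at (integral_part L) fls_X 0"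
    using at_origin_integral by (auto simp: at_origin_def)
  have "fls.val_at (integral_part L) (1 - fls_const k * fls_X\<^sup>2) (1 - k * 0\<^sup>2)"
    by (intro fls.val_at_intros[OF subfield_L V0(1)] V0)
  then show ?thesis by (rule val_at_origin_nonzero) simp
qed

lemma y_nonzero: "y \<noteq> 0"
  using val_at_origin_nonzero[of y 1] at_origin_integral by (simp add: at_origin_def)

text \<open>As \<alpha> \<noteq> \<beta>, x^2 is a fractional linear function of v; then u yields x
  y, because its remaining factor is a nonzero function of x^2. Hypothesis \<open>h\<close> is about
  residue values only, so u may be rewritten as any fraction whose denominator survives at the point
  considered.\<close>

lemma two_isogeny:
  fixes D l a b \<alpha> \<beta> :: 'a
  defines "u \<equiv> fls_X * y * (fls_const l * (1 - fls_const a * fls_X\<^sup>2) / (1 - fls_const b * fls_X\<^sup>2))"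
    and "v \<equiv> (1 - fls_const \<alpha> * fls_X\<^sup>2) / (1 - fls_const \<beta> * fls_X\<^sup>2)"
  assumes D: "D \<noteq> 1" and l: "l \<noteq> 0" and ne: "\<alpha> \<noteq> \<beta>"
    and eq: "u\<^sup>2 + v\<^sup>2 = 1 + fls_const D * u\<^sup>2 * v\<^sup>2"
    and h: "\<And>V x0 y0 u1 u2 v1 v2. fls.val_ring L V \<Longrightarrow> fls.val_at V fls_X x0 \<Longrightarrow> fls.val_at V y y0 \<Longrightarrow>
        h x0 y0 = ((u1, u2), (v1, v2)) \<Longrightarrow> u2 \<noteq> 0 \<Longrightarrow> v2 \<noteq> 0 \<Longrightarrow>
        fls.val_at V u (u1 / u2) \<and> fls.val_at V v (v1 / v2)"
  shows "\<exists>\<phi>. edwards_isogeny 2 c D \<phi> \<and> edwards_given_by c D \<phi> h"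
proof -
  note o = at_origin_integral
  have V0: "fls.val_ring L (integral_part L)" "fls.val_at (integral_part L) fls_X 0"
    "fls.val_at (integral_part L) y 1" using o by (auto simp: at_origin_def)
  have X0: "fls_X \<noteq> (0 :: 'a fls)" by simp
  note nz = one_minus_nonzero and y0 = y_nonzero
  define r where "r = fls_const l * (1 - fls_const a * fls_X\<^sup>2) / (1 - fls_const b * fls_X\<^sup>2)"
  have r0: "r \<noteq> 0" using nz l by (simp add: r_def)
  have u: "u = fls_X * y * r" by (simp add: u_def r_def)
  have u0: "u \<noteq> 0" using X0 y0 r0 by (simp add: u)
  have uv_origin: "fls.val_at V u 0" "fls.val_at V v 1" if "at_origin V" for V
  proof -
    have V: "fls.val_ring L V" "fls.val_at V fls_X 0" "fls.val_at V y 1" using that by (auto simp: at_origin_def)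
    have "fls.val_at V u (0 * 1 * (l * (1 - a * 0\<^sup>2) / (1 - b * 0\<^sup>2)))"
      "fls.val_at V v ((1 - \<alpha> * 0\<^sup>2) / (1 - \<beta> * 0\<^sup>2))"
      unfolding u_def v_def by (intro fls.val_at_intros[OF subfield_L V(1)] V, simp)+
    then show "fls.val_at V u 0" "fls.val_at V v 1" by simp_all
  qed
  \<comment> \<open>u vanishes at the origin without being zero.\<close>
  have uc: "u \<notin> range fls_const"
  proof
    assume "u \<in> range fls_const"
    then obtain k where k: "u = fls_const k" by auto
    then have "k = 0"
      using fls.val_at_unique[OF subfield_L V0(1) uv_origin(1)[OF o]]
        fls.val_at_const[OF subfield_L V0(1), of k] by auto
    then show False using k u0 by simp
  qed
  interpret U: generic_point fls_const "edwards_poly D" u v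
    by (rule fls.edwards_generic_point[OF two D uc eq])
  define M where "M = fls.generated {u, v}"
  have M: "fls.const_subfield M" unfolding M_def by (rule fls.const_subfield_generated)
  have uM: "u \<in> M" and vM: "v \<in> M" by (auto simp: M_def intro: fls.generated_incl)
  note Mi = fls.sf_intros[OF M]
  note Li = fls.sf_intros[OF subfield_L]
  have M_sub: "M \<subseteq> L" unfolding M_def
    using X_in_L y_in_L by (intro fls.generated_least[OF subfield_L]) (auto simp: u_def v_def intro!: Li)
  have v1: "v \<noteq> 1"
  proof
    assume "v = 1"
    then have "fls_const \<alpha> * fls_X\<^sup>2 = fls_const \<beta> * (fls_X\<^sup>2 :: 'a fls)" using nz[of \<beta>] by (simp add: v_def)
    then show False using ne by simp
  qed
  have XM: "fls_X\<^sup>2 \<in> M"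
  proof -
    have "v * (1 - fls_const \<beta> * fls_X\<^sup>2) = 1 - fls_const \<alpha> * fls_X\<^sup>2" using nz[of \<beta>] by (simp add: v_def)
    then have *: "fls_X\<^sup>2 * (fls_const \<alpha> - v * fls_const \<beta>) = 1 - v" by (simp add: algebra_simps)
    then have "fls_const \<alpha> - v * fls_const \<beta> \<noteq> 0" using v1 by auto
    then have "fls_X\<^sup>2 = (1 - v) / (fls_const \<alpha> - v * fls_const \<beta>)" using * nonzero_eq_divide_eq by blast
    also have "\<dots> \<in> M" by (intro Mi vM)
    finally show ?thesis .
  qed
  have "r \<in> M" unfolding r_def by (intro Mi XM)
  then have "u / r \<in> M" by (intro Mi uM)
  then have XyM: "fls_X * y \<in> M" using r0 by (simp add: u)
  \<comment> \<open>The curve equation is even in both coordinates, so the negated point is again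
    generic.\<close>
  have curve': "(- fls_X)\<^sup>2 + (- y)\<^sup>2 = 1 + fls_const c * (- fls_X)\<^sup>2 * (- y)\<^sup>2" using curve by simp
  have "- fls_X \<notin> range (fls_const :: 'a \<Rightarrow> 'a fls)"
  proof
    assume "- fls_X \<in> range (fls_const :: 'a \<Rightarrow> 'a fls)"
    then obtain k :: 'a where "- fls_X = fls_const k" by auto
    then have "fls_subdegree (- fls_X :: 'a fls) = 0" by (simp only: fls_const_subdegree)
    then show False by simp
  qed
  then have gen': "generic_point fls_const (edwards_poly c) (- fls_X) (- y)"
    using fls.edwards_generic_point[OF two c _ curve'] by simp
  obtain \<sigma> where \<sigma>: "\<And>z. z \<in> L \<Longrightarrow> \<sigma> z \<in> fls.generated {- fls_X, - y}"
    "\<And>z w. z \<in> L \<Longrightarrow> w \<in> L \<Longrightarrow> \<sigma> (z + w) = \<sigma> z + \<sigma> w"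
    "\<And>z w. z \<in> L \<Longrightarrow> w \<in> L \<Longrightarrow> \<sigma> (z * w) = \<sigma> z * \<sigma> w"
    "\<And>a. \<sigma> (fls_const a) = fls_const a" "\<sigma> fls_X = - fls_X" "\<sigma> y = - y"
    using fls.generic_points_conjugate[OF generic_point_axioms gen'] by blast
  have "fls.generated {- fls_X, - y} \<subseteq> L"
    using X_in_L y_in_L by (intro fls.generated_least[OF subfield_L]) (auto intro: Li)
  then have \<sigma>L: "\<sigma> z \<in> L" if "z \<in> L" for z using \<sigma>(1)[OF that] by blast
  define Fix where "Fix = {z \<in> L. \<sigma> z = z}"
  have Fix: "fls.const_subfield Fix"
  proof (rule fls.const_subfieldI)
    fix z assume z: "z \<in> Fix" "z \<noteq> 0"
    then have zL: "z \<in> L" "inverse z \<in> L" "\<sigma> z = z" by (auto simp: Fix_def intro: Li)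
    have "\<sigma> (inverse z) * z = 1" using \<sigma>(3)[OF zL(2,1)] \<sigma>(4)[of 1] z zL by simp
    then have "\<sigma> (inverse z) = inverse z" using z(2) by (simp add: field_simps)
    then show "inverse z \<in> Fix" using zL by (simp add: Fix_def)
  qed (auto simp: Fix_def \<sigma> intro: Li)
  note Fi = fls.sf_intros[OF Fix]
  have "fls_X\<^sup>2 \<in> Fix" "fls_X * y \<in> Fix"
    using X_in_L y_in_L by (auto simp: Fix_def \<sigma> power2_eq_square intro: Li)
  then have "{u, v} \<subseteq> Fix" by (auto simp: u_def v_def intro!: Fi)
  then have M_Fix: "M \<subseteq> Fix" unfolding M_def by (rule fls.generated_least[OF Fix])
  then have \<sigma>M: "\<sigma> z = z" if "z \<in> M" for z using that by (auto simp: Fix_def)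
  have "(2 :: 'a fls) \<noteq> 0" using two fls.emb_eq_0_iff[of "2::'a"] by (simp only: fls.emb_2) simp
  \<comment> \<open>\<sigma> fixes \<open>M\<close> but negates x, and x \<noteq> -x in
    characteristic other than 2.\<close>
  then have X_M: "fls_X \<notin> M"
    using \<sigma>M[of fls_X] \<sigma>(5) X0 by (auto simp: eq_neg_iff_add_eq_0 simp flip: mult_2)
  define N where "N = {a + b * fls_X | a b. a \<in> M \<and> b \<in> M}"
  have NI: "a + b * fls_X \<in> N" if "a \<in> M" "b \<in> M" for a b using that by (auto simp: N_def)
  \<comment> \<open>A nontrivial zero of the norm form would make x equal to a / b or - a / b, an
    element of \<open>M\<close>. Nonzero norms then provide inverses in M + M x.\<close>
  have norm0: "a = 0 \<and> b = 0" if ab: "a \<in> M" "b \<in> M" "a * a - b * b * fls_X\<^sup>2 = 0" for a b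
  proof (cases "b = 0")
    case False
    have "(a - b * fls_X) * (a + b * fls_X) = 0" using ab(3) by (simp add: algebra_simps power2_eq_square)
    then have "fls_X = a / b \<or> fls_X = - a / b"
      using False by (auto simp: nonzero_eq_divide_eq mult.commute add_eq_0_iff2)
    moreover have "a / b \<in> M" "- a / b \<in> M" using ab by (auto intro: Mi)
    ultimately show ?thesis using X_M by auto
  qed (use ab in simp)
  have N: "fls.const_subfield N"
  proof (rule fls.const_subfieldI)
    show "fls_const k \<in> N" for k using NI[of "fls_const k" 0] by (simp add: Mi)
    fix z w assume "z \<in> N" "w \<in> N"
    then obtain a b a' b' where *: "z = a + b * fls_X" "w = a' + b' * fls_X" "a \<in> M" "b \<in> M" "a' \<in> M" "b' \<in> M"
      by (auto simp: N_def)
    have "z + w = (a + a') + (b + b') * fls_X"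
      "z * w = (a * a' + b * b' * fls_X\<^sup>2) + (a * b' + b * a') * fls_X"
      by (simp_all add: * algebra_simps power2_eq_square)
    moreover have "a + a' \<in> M" "b + b' \<in> M" "a * a' + b * b' * fls_X\<^sup>2 \<in> M" "a * b' + b * a' \<in> M"
      using * XM by (auto intro!: Mi)
    ultimately show "z + w \<in> N" "z * w \<in> N" using NI by simp_all
  next
    fix z assume "z \<in> N" "z \<noteq> 0"
    then obtain a b where *: "z = a + b * fls_X" "a \<in> M" "b \<in> M" "z \<noteq> 0" by (auto simp: N_def)
    define n where "n = a * a - b * b * fls_X\<^sup>2"
    have n0: "n \<noteq> 0" using norm0[OF *(2,3)] *(1,4) by (auto simp: n_def)
    have "z * (a / n + (- b / n) * fls_X) = (z * (a - b * fls_X)) / n"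
      by (simp add: diff_divide_distrib right_diff_distrib mult_ac)
    also have "z * (a - b * fls_X) = n" by (simp add: * n_def algebra_simps power2_eq_square)
    finally have "inverse z = a / n + (- b / n) * fls_X" using n0 by (intro inverse_unique) simp
    moreover have "n \<in> M" unfolding n_def using * by (intro fls.sf_diff[OF M] fls.sf_mult[OF M] XM) auto
    ultimately show "inverse z \<in> N" using * by (simp only:) (intro NI Mi)
  qed
  \<comment> \<open>Exhibits y as (x y / x^2) x, a multiple of x by an element of
    \<open>M\<close>.\<close>
  have "0 + (x * y / x\<^sup>2) * x = y" if "x \<noteq> 0" for x :: "'a fls"
    using that by (simp add: power2_eq_square)
  from this[OF X0] have "y = 0 + (fls_X * y / fls_X\<^sup>2) * fls_X" by (rule sym)
  moreover have "0 + (fls_X * y / fls_X\<^sup>2) * fls_X \<in> N" by (intro NI fls.sf_0[OF M] fls.sf_divide[OF M] XyM XM)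
  ultimately have "y \<in> N" by (simp only:)
  moreover have "fls_X \<in> N" using NI[of 0 1] by (simp add: Mi)
  ultimately have "L \<subseteq> N" by (intro fls.generated_least[OF N]) auto
  moreover have "N \<subseteq> L" using M_sub X_in_L by (auto simp: N_def intro!: Li)
  ultimately have LN: "L = N" by auto
  have \<sigma>_basis: "\<sigma> (a + b * fls_X) = a - b * fls_X" if "a \<in> M" "b \<in> M" for a b
  proof -
    have "a \<in> L" "b \<in> L" using that M_sub by auto
    then show ?thesis using that X_in_L by (simp add: \<sigma> \<sigma>M Li)
  qed
  interpret Q: quadratic_cover fls_const L M \<sigma> "edwards_field c" "fls.curve_eval (edwards_poly c) fls_X y"
    "edwards_field D" "fls.curve_eval (edwards_poly D) u v" fls_X
  proof (intro quadratic_cover.intro quadratic_cover_axioms.intro involution.intro involution_axioms.intro)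
    show "field_model fls_const (edwards_field c) (fls.curve_eval (edwards_poly c) fls_X y)"
      by (rule E.field_model_axioms)
    show "field_model fls_const (edwards_field D) (fls.curve_eval (edwards_poly D) u v)"
      using U.plane_model by (simp add: edwards_field_def)
    show "fls.curve_eval (edwards_poly c) fls_X y ` carrier (edwards_field c) = L" by (rule E_image)
    show "fls.curve_eval (edwards_poly D) u v ` carrier (edwards_field D) = M"
      using U.plane_model_image by (simp add: edwards_field_def M_def)
    show "L = {a + b * fls_X |a b. a \<in> M \<and> b \<in> M}" by (simp add: LN N_def)
    fix z assume "z \<in> L"
    then obtain a b where ab: "z = a + b * fls_X" "a \<in> M" "b \<in> M" by (auto simp: LN N_def)
    have mb: "- b \<in> M" using ab by (intro Mi)
    show "\<sigma> (\<sigma> z) = z"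
      using \<sigma>_basis[OF ab(2,3)] \<sigma>_basis[OF ab(2) mb] by (simp add: ab(1))
    have "z + \<sigma> z = a + a" "z * \<sigma> z = a * a - b * b * fls_X\<^sup>2"
      unfolding ab(1) \<sigma>_basis[OF ab(2,3)] by (simp_all add: algebra_simps power2_eq_square)
    then show "z + \<sigma> z \<in> M" "z * \<sigma> z \<in> M"
      using ab XM by (simp_all only: fls.sf_add[OF M] fls.sf_diff[OF M] fls.sf_mult[OF M])
  qed (fact fls.constant_embedding_axioms subfield_L M M_sub \<sigma>L \<sigma>(2) \<sigma>(3) \<sigma>M X_in_L X_M)+
  let ?\<psi> = "fls.curve_eval (edwards_poly c) fls_X y"
  have coords: "edwards_coords D (Q.\<phi> P) k m \<longleftrightarrow> fls.val_at (?\<psi> ` P) u k \<and> fls.val_at (?\<psi> ` P) v m"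
    if P: "P \<in> places (edwards_field c)" for P k m
    using U.edwards_coords_iff[OF refl Q.\<phi>_places[OF P]] fls.val_at_trace[OF M] uM vM
    by (simp add: Q.image_\<phi>)
  have "edwards_coords D (Q.\<phi> (edwards_origin c)) 0 1"
    using coords[OF origin(1)] uv_origin coords_origin_iff[of "edwards_origin c"] origin by simp
  \<comment> \<open>The target's origin is characterized through its own expansion; the pair (u, v)
    serves only to embed its function field.\<close>
  moreover obtain y' where y': "edwards_series D y'" using edwards_series_exists[OF two D] by blast
  ultimately have "Q.\<phi> (edwards_origin c) = edwards_origin D"
    using edwards_series.origin_eqI[OF y'] Q.\<phi>_places[OF origin(1)] by blast
  then have "edwards_isogeny 2 c D Q.\<phi>"
    using Q.curve_morphism Q.degree by (simp add: edwards_isogeny_def isogeny_of_degree_def)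
  moreover have "edwards_given_by c D Q.\<phi> h"
    unfolding edwards_given_by_def
  proof (intro ballI allI impI)
    fix P x0 y0 u1 u2 v1 v2
    assume P: "P \<in> places (edwards_field c)"
      and *: "edwards_coords c P x0 y0 \<and> h x0 y0 = ((u1, u2), (v1, v2)) \<and> u2 \<noteq> 0 \<and> v2 \<noteq> 0"
    have "fls.val_ring L (?\<psi> ` P)" using E.places_val_ring[OF P] by (simp add: E_image)
    moreover have "fls.val_at (?\<psi> ` P) fls_X x0" "fls.val_at (?\<psi> ` P) y y0"
      using * edwards_coords_iff[OF refl P] by auto
    ultimately show "edwards_coords D (Q.\<phi> P) (u1 / u2) (v1 / v2)"
      using coords[OF P] h * by blast
  qed
  ultimately show ?thesis by blast
qed

end


section \<open>The three pairs of isogenies\<close>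

lemma sqrt_ne_pm1:
  fixes s :: "'a::field"
  assumes "s\<^sup>2 \<noteq> 1" shows "1 - s \<noteq> 0" "1 + s \<noteq> 0"
proof -
  have "(1 - s) * (1 + s) \<noteq> 0" using assms by (simp add: algebra_simps power2_eq_square)
  then show "1 - s \<noteq> 0" "1 + s \<noteq> 0" by auto
qed

lemma quotient_square_ne:
  fixes s :: "'a::field"
  assumes two: "(2::'a) \<noteq> 0" and s: "s \<noteq> 0" "s\<^sup>2 \<noteq> 1"
  shows "((1 + s) / (1 - s))\<^sup>2 \<noteq> 0" "((1 + s) / (1 - s))\<^sup>2 \<noteq> 1"
proof -
  note n = sqrt_ne_pm1[OF s(2)]
  show "((1 + s) / (1 - s))\<^sup>2 \<noteq> 0" using n by simp
  show "((1 + s) / (1 - s))\<^sup>2 \<noteq> 1"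
  proof
    assume "((1 + s) / (1 - s))\<^sup>2 = 1"
    then have "(1 + s)\<^sup>2 = (1 - s)\<^sup>2" using n by (simp add: power_divide)
    then have "2 * (2 * s) = 0" by (simp add: power2_eq_square algebra_simps)
    then show False using two s by (simp only: mult_eq_0_iff) simp
  qed
qed

text \<open>Clearing denominators turns the Edwards equation of \<open>(u, v)\<close> into an identity in \<open>x\<^sup>2\<close>.\<close>

lemma edwards_equationI:
  fixes u v :: "'a::field"
  assumes "(1 - s) \<noteq> 0" "w \<noteq> 0" "q \<noteq> 0" and D: "D = ((1 + s) / (1 - s))\<^sup>2"
    and u: "q * u\<^sup>2 = p" and v: "v = m / w"
    and id: "p * (((1 - s) * w)\<^sup>2 - ((1 + s) * m)\<^sup>2) = q * ((1 - s)\<^sup>2 * (w\<^sup>2 - m\<^sup>2))"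
  shows "u\<^sup>2 + v\<^sup>2 = 1 + D * u\<^sup>2 * v\<^sup>2"
proof -
  have v': "v * w = m" using assms by simp
  have D': "D * (1 - s)\<^sup>2 = (1 + s)\<^sup>2" using assms by (simp add: power_divide)
  have "q * (1 - s)\<^sup>2 * w\<^sup>2 * (u\<^sup>2 * (1 - D * v\<^sup>2))
      = (q * u\<^sup>2) * ((1 - s)\<^sup>2 * w\<^sup>2 - (D * (1 - s)\<^sup>2) * (v * w)\<^sup>2)"
    by (simp add: algebra_simps power_mult_distrib)
  also have "\<dots> = q * ((1 - s)\<^sup>2 * (w\<^sup>2 - (v * w)\<^sup>2))"
    using id unfolding u D' v' by (simp add: power_mult_distrib)
  also have "\<dots> = q * (1 - s)\<^sup>2 * w\<^sup>2 * (1 - v\<^sup>2)" by (simp add: algebra_simps power_mult_distrib)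
  finally have "u\<^sup>2 * (1 - D * v\<^sup>2) = 1 - v\<^sup>2" using assms by simp
  then show ?thesis by (simp add: algebra_simps)
qed

context edwards_series
begin

lemma curve_y: "y\<^sup>2 * (1 - fls_const c * fls_X\<^sup>2) = 1 - fls_X\<^sup>2"
  using curve by (simp add: algebra_simps)

text \<open>Here (1 - v^2) / (1 - D v^2) = - (1 - s)^2 x^2 / ((1 - x^2)(1 - c x^2)), the negative of
  the square of (1 - s) x y / (1 - x^2). The sign is why a square root of -1 enters.\<close>

lemma isogeny_sqrt_d:
  assumes i: "i\<^sup>2 = -1" and s: "s\<^sup>2 = c" and c0: "c \<noteq> 0" and D: "D = ((1 + s) / (1 - s))\<^sup>2"
  shows "\<exists>\<phi>. edwards_isogeny 2 c D \<phi> \<and> edwards_given_by c D \<phi> (\<lambda>x y.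
       ((i * (1 - s) / (c - 1) * (1 - y\<^sup>2), x * y), (1 - s * x\<^sup>2, 1 + s * x\<^sup>2)))"
proof -
  have s0: "s \<noteq> 0" and s1: "s\<^sup>2 \<noteq> 1" using s c0 c by auto
  note n = sqrt_ne_pm1[OF s1]
  define S where "S = fls_const s"
  define x :: "'a fls" where "x = fls_X"
  define l where "l = - i * (1 - s)"
  have c_S: "fls_const c = S\<^sup>2" by (simp add: S_def flip: s fls.emb_power)
  have w: "1 + S * x\<^sup>2 \<noteq> 0" "1 - x\<^sup>2 \<noteq> 0" "x \<noteq> 0"
    using one_minus_nonzero[of "- s"] one_minus_nonzero[of 1] by (simp_all add: S_def x_def)
  have w': "1 - S\<^sup>2 * x\<^sup>2 \<noteq> 0" using one_minus_nonzero[of c] by (simp only: c_S x_def) simp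
  have yx: "y\<^sup>2 * (1 - S\<^sup>2 * x\<^sup>2) = 1 - x\<^sup>2" using curve_y by (simp add: c_S x_def)
  define u where "u = x * y * (fls_const l / (1 - x\<^sup>2))"
  define v where "v = (1 - S * x\<^sup>2) / (1 + S * x\<^sup>2)"
  have l2: "(fls_const l)\<^sup>2 = - ((1 - S)\<^sup>2)"
  proof -
    have "l\<^sup>2 = - ((1 - s)\<^sup>2)" using i by (simp add: l_def power_mult_distrib)
    from arg_cong[OF this, of fls_const] show ?thesis by (simp only: S_def fls.emb_simps fls.emb_1)
  qed
  have eq: "u\<^sup>2 + v\<^sup>2 = 1 + fls_const D * u\<^sup>2 * v\<^sup>2"
  proof (rule edwards_equationI)
    show "1 - S \<noteq> 0" using n(1) fls.emb_eq_0_iff[of "1 - s"] by (simp add: S_def fls.emb_diff)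
    show "fls_const D = ((1 + S) / (1 - S))\<^sup>2" by (simp only: D S_def fls.emb_simps fls.emb_1)
    show "v = (1 - S * x\<^sup>2) / (1 + S * x\<^sup>2)" by (rule v_def)
    show "(1 - x\<^sup>2) * (1 - S\<^sup>2 * x\<^sup>2) \<noteq> 0" using w w' by simp
    have "u * (1 - x\<^sup>2) = x * y * fls_const l" using w by (simp add: u_def)
    then have "u\<^sup>2 * (1 - x\<^sup>2)\<^sup>2 = x\<^sup>2 * y\<^sup>2 * (fls_const l)\<^sup>2" by (metis power_mult_distrib)
    then have "u\<^sup>2 * (1 - x\<^sup>2)\<^sup>2 * (1 - S\<^sup>2 * x\<^sup>2) = x\<^sup>2 * (y\<^sup>2 * (1 - S\<^sup>2 * x\<^sup>2)) * (fls_const l)\<^sup>2" by simp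
    then have "(1 - x\<^sup>2) * ((1 - x\<^sup>2) * (1 - S\<^sup>2 * x\<^sup>2) * u\<^sup>2) = (1 - x\<^sup>2) * (- (x\<^sup>2 * (1 - S)\<^sup>2))"
      unfolding yx l2 by (simp add: power2_eq_square mult_ac)
    then show "(1 - x\<^sup>2) * (1 - S\<^sup>2 * x\<^sup>2) * u\<^sup>2 = - (x\<^sup>2 * (1 - S)\<^sup>2)"
      by (rule mult_left_cancel[OF w(2), THEN iffD1])
    have "((1 - S) * (1 + S * x\<^sup>2))\<^sup>2 - ((1 + S) * (1 - S * x\<^sup>2))\<^sup>2 = - 4 * S * (1 - x\<^sup>2) * (1 - S\<^sup>2 * x\<^sup>2)"
      by (simp add: algebra_simps power2_eq_square)
    moreover have "(1 + S * x\<^sup>2)\<^sup>2 - (1 - S * x\<^sup>2)\<^sup>2 = 4 * S * x\<^sup>2"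
      by (simp add: algebra_simps power2_eq_square)
    ultimately show "- (x\<^sup>2 * (1 - S)\<^sup>2) * (((1 - S) * (1 + S * x\<^sup>2))\<^sup>2 - ((1 + S) * (1 - S * x\<^sup>2))\<^sup>2)
        = (1 - x\<^sup>2) * (1 - S\<^sup>2 * x\<^sup>2) * ((1 - S)\<^sup>2 * ((1 + S * x\<^sup>2)\<^sup>2 - (1 - S * x\<^sup>2)\<^sup>2))"
      by (simp add: mult_ac)
  qed (fact w)
  \<comment> \<open>The curve equation in the form (1 - x^2)(1 - y^2) = (1 - c) x^2 y^2 replaces (1
    - y^2) / (x y) by (1 - c) x y / (1 - x^2).\<close>
  have u_alt: "u = fls_const (i * (1 - s) / (c - 1)) * (1 - y\<^sup>2) / (x * y)"
  proof -
    have "(1 - y\<^sup>2) * (1 - x\<^sup>2) = (1 - S\<^sup>2) * (x\<^sup>2 * y\<^sup>2)" using yx by (simp add: algebra_simps)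
    moreover have "fls_const l = fls_const (i * (1 - s) / (c - 1)) * (1 - S\<^sup>2)"
    proof -
      have "l = i * (1 - s) / (c - 1) * (1 - c)" using c by (simp add: l_def field_simps)
      then have "fls_const l = fls_const (i * (1 - s) / (c - 1)) * fls_const (1 - c)"
        by (simp only: fls.emb_mult)
      then show ?thesis by (simp only: fls.emb_diff fls.emb_1 c_S)
    qed
    ultimately have "x * y * fls_const l * (x * y) = fls_const (i * (1 - s) / (c - 1)) * (1 - y\<^sup>2) * (1 - x\<^sup>2)"
      by (simp add: power2_eq_square mult_ac)
    then show ?thesis using w y_nonzero by (simp add: u_def frac_eq_eq)
  qed
  show ?thesis
  proof (rule two_isogeny[where l = l and a = 0 and b = 1 and \<alpha> = s and \<beta> = "- s"])
    show "D \<noteq> 1" using quotient_square_ne[OF two s0 s1] D by simp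
    show "l \<noteq> 0" using i n by (auto simp: l_def)
    have "2 * s \<noteq> 0" using two s0 by simp
    then show "s \<noteq> - s" by (metis mult_2 eq_neg_iff_add_eq_0)
    have u': "fls_X * y * (fls_const l * (1 - fls_const 0 * fls_X\<^sup>2) / (1 - fls_const 1 * fls_X\<^sup>2)) = u"
      and v': "(1 - fls_const s * fls_X\<^sup>2) / (1 - fls_const (- s) * fls_X\<^sup>2) = v"
      by (simp_all add: u_def v_def x_def S_def)
    show "(fls_X * y * (fls_const l * (1 - fls_const 0 * fls_X\<^sup>2) / (1 - fls_const 1 * fls_X\<^sup>2)))\<^sup>2 +
        ((1 - fls_const s * fls_X\<^sup>2) / (1 - fls_const (- s) * fls_X\<^sup>2))\<^sup>2 = 1 + fls_const D *
        (fls_X * y * (fls_const l * (1 - fls_const 0 * fls_X\<^sup>2) / (1 - fls_const 1 * fls_X\<^sup>2)))\<^sup>2 *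
        ((1 - fls_const s * fls_X\<^sup>2) / (1 - fls_const (- s) * fls_X\<^sup>2))\<^sup>2"
      unfolding u' v' by (rule eq)
    fix V and x0 y0 u1 u2 v1 v2 :: 'a
    assume V: "fls.val_ring L V" and xy: "fls.val_at V fls_X x0" "fls.val_at V y y0"
      and h: "((i * (1 - s) / (c - 1) * (1 - y0\<^sup>2), x0 * y0), (1 - s * x0\<^sup>2, 1 + s * x0\<^sup>2)) = ((u1, u2), (v1, v2))"
      and nz: "u2 \<noteq> 0" "v2 \<noteq> 0"
    have "fls.val_at V u (i * (1 - s) / (c - 1) * (1 - y0\<^sup>2) / (x0 * y0))"
      "fls.val_at V v ((1 - s * x0\<^sup>2) / (1 + s * x0\<^sup>2))"
      unfolding u_alt v_def S_def x_def using h nz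
      by (intro fls.val_at_intros[OF subfield_L V] xy; simp)+
    then show "fls.val_at V (fls_X * y * (fls_const l * (1 - fls_const 0 * fls_X\<^sup>2) / (1 - fls_const 1 * fls_X\<^sup>2))) (u1 / u2) \<and>
        fls.val_at V ((1 - fls_const s * fls_X\<^sup>2) / (1 - fls_const (- s) * fls_X\<^sup>2)) (v1 / v2)"
      unfolding u' v' using h by auto
  qed
qed

text \<open>Up to the common factor -4 s, the two differences of squares are x^2 (1 - x^2) and 1 - c
  x^2. Their quotient is (x y)^2, so u is simply a multiple of x y.\<close>

lemma isogeny_sqrt_one_minus_d:
  assumes s: "s\<^sup>2 = 1 - c" and c0: "c \<noteq> 0" and D: "D = ((1 + s) / (1 - s))\<^sup>2"
  shows "\<exists>\<phi>. edwards_isogeny 2 c D \<phi> \<and> edwards_given_by c D \<phi> (\<lambda>x y.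
       (((1 - s) * x * y, 1), (1 - (1 - s) * x\<^sup>2, 1 - (1 + s) * x\<^sup>2)))"
proof -
  have s0: "s \<noteq> 0" and s1: "s\<^sup>2 \<noteq> 1" using s c0 c by auto
  note n = sqrt_ne_pm1[OF s1]
  define S where "S = fls_const s"
  define x :: "'a fls" where "x = fls_X"
  have c_S: "fls_const c = 1 - S\<^sup>2"
    using arg_cong[OF s, of fls_const] by (simp add: S_def fls.emb_power fls.emb_diff)
  have w: "1 - (1 + S) * x\<^sup>2 \<noteq> 0" "1 - (1 - S\<^sup>2) * x\<^sup>2 \<noteq> 0"
    using one_minus_nonzero[of "1 + s"] one_minus_nonzero[of c]
    by (simp_all only: S_def x_def c_S fls.emb_add fls.emb_1 not_False_eq_True)
  have yx: "y\<^sup>2 * (1 - (1 - S\<^sup>2) * x\<^sup>2) = 1 - x\<^sup>2" using curve_y by (simp only: c_S x_def)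
  define u where "u = x * y * (1 - S)"
  define v where "v = (1 - (1 - S) * x\<^sup>2) / (1 - (1 + S) * x\<^sup>2)"
  have eq: "u\<^sup>2 + v\<^sup>2 = 1 + fls_const D * u\<^sup>2 * v\<^sup>2"
  proof (rule edwards_equationI)
    show "1 - S \<noteq> 0" using n(1) fls.emb_eq_0_iff[of "1 - s"] by (simp add: S_def fls.emb_diff)
    show "fls_const D = ((1 + S) / (1 - S))\<^sup>2" by (simp only: D S_def fls.emb_simps fls.emb_1)
    show "v = (1 - (1 - S) * x\<^sup>2) / (1 - (1 + S) * x\<^sup>2)" by (rule v_def)
    have "(1 - (1 - S\<^sup>2) * x\<^sup>2) * u\<^sup>2 = x\<^sup>2 * (y\<^sup>2 * (1 - (1 - S\<^sup>2) * x\<^sup>2)) * (1 - S)\<^sup>2"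
      by (simp only: u_def power_mult_distrib mult_ac)
    then show "(1 - (1 - S\<^sup>2) * x\<^sup>2) * u\<^sup>2 = x\<^sup>2 * (1 - x\<^sup>2) * (1 - S)\<^sup>2" unfolding yx .
    have "((1 - S) * (1 - (1 + S) * x\<^sup>2))\<^sup>2 - ((1 + S) * (1 - (1 - S) * x\<^sup>2))\<^sup>2 = - 4 * S * (1 - (1 - S\<^sup>2) * x\<^sup>2)"
      by (simp add: algebra_simps power2_eq_square)
    moreover have "(1 - (1 + S) * x\<^sup>2)\<^sup>2 - (1 - (1 - S) * x\<^sup>2)\<^sup>2 = - 4 * S * (x\<^sup>2 * (1 - x\<^sup>2))"
      by (simp add: algebra_simps power2_eq_square)
    ultimately show "x\<^sup>2 * (1 - x\<^sup>2) * (1 - S)\<^sup>2 *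
          (((1 - S) * (1 - (1 + S) * x\<^sup>2))\<^sup>2 - ((1 + S) * (1 - (1 - S) * x\<^sup>2))\<^sup>2)
        = (1 - (1 - S\<^sup>2) * x\<^sup>2) * ((1 - S)\<^sup>2 * ((1 - (1 + S) * x\<^sup>2)\<^sup>2 - (1 - (1 - S) * x\<^sup>2)\<^sup>2))"
      by (simp only: mult_ac)
  qed (fact w)+
  show ?thesis
  proof (rule two_isogeny[where l = "1 - s" and a = 0 and b = 0 and \<alpha> = "1 - s" and \<beta> = "1 + s"])
    show "D \<noteq> 1" using quotient_square_ne[OF two s0 s1] D by simp
    show "1 - s \<noteq> 0" by (fact n)
    have "2 * s \<noteq> 0" using two s0 by simp
    then show "1 - s \<noteq> 1 + s" by (metis mult_2 eq_neg_iff_add_eq_0 add_left_cancel diff_conv_add_uminus)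
    have u': "fls_X * y * (fls_const (1 - s) * (1 - fls_const 0 * fls_X\<^sup>2) / (1 - fls_const 0 * fls_X\<^sup>2)) = u"
      and v': "(1 - fls_const (1 - s) * fls_X\<^sup>2) / (1 - fls_const (1 + s) * fls_X\<^sup>2) = v"
      by (simp_all add: u_def v_def x_def S_def fls.emb_diff fls.emb_add)
    show "(fls_X * y * (fls_const (1 - s) * (1 - fls_const 0 * fls_X\<^sup>2) / (1 - fls_const 0 * fls_X\<^sup>2)))\<^sup>2 +
        ((1 - fls_const (1 - s) * fls_X\<^sup>2) / (1 - fls_const (1 + s) * fls_X\<^sup>2))\<^sup>2 = 1 + fls_const D *
        (fls_X * y * (fls_const (1 - s) * (1 - fls_const 0 * fls_X\<^sup>2) / (1 - fls_const 0 * fls_X\<^sup>2)))\<^sup>2 *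
        ((1 - fls_const (1 - s) * fls_X\<^sup>2) / (1 - fls_const (1 + s) * fls_X\<^sup>2))\<^sup>2"
      unfolding u' v' by (rule eq)
    fix V and x0 y0 u1 u2 v1 v2 :: 'a
    assume V: "fls.val_ring L V" and xy: "fls.val_at V fls_X x0" "fls.val_at V y y0"
      and h: "(((1 - s) * x0 * y0, 1), (1 - (1 - s) * x0\<^sup>2, 1 - (1 + s) * x0\<^sup>2)) = ((u1, u2), (v1, v2))"
      and nz: "u2 \<noteq> 0" "v2 \<noteq> 0"
    have "fls.val_at V u (x0 * y0 * (1 - s))"
      "fls.val_at V v ((1 - (1 - s) * x0\<^sup>2) / (1 - (1 + s) * x0\<^sup>2))"
      unfolding u_def v_def S_def x_def using h nz
      by (intro fls.val_at_intros[OF subfield_L V] xy; simp)+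
    then show "fls.val_at V (fls_X * y * (fls_const (1 - s) * (1 - fls_const 0 * fls_X\<^sup>2) / (1 - fls_const 0 * fls_X\<^sup>2))) (u1 / u2) \<and>
        fls.val_at V ((1 - fls_const (1 - s) * fls_X\<^sup>2) / (1 - fls_const (1 + s) * fls_X\<^sup>2)) (v1 / v2)"
      unfolding u' v' using h by (auto simp: mult_ac)
  qed
qed

text \<open>The compatibility s = t / r gives r - t = r (1 - s), whose square is the value (c - 1)(1
  - s)^2 demanded by \<open>edwards_third_scaling\<close>.\<close>

lemma isogeny_sqrt_quotient:
  assumes s: "s = t / r" and r: "r\<^sup>2 = c - 1" and t: "t\<^sup>2 = c" and c0: "c \<noteq> 0"
    and D: "D = ((1 + s) / (1 - s))\<^sup>2"
  shows "\<exists>\<phi>. edwards_isogeny 2 c D \<phi> \<and> edwards_given_by c D \<phi> (\<lambda>x y.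
       (((r - t) * x, y), (1 - (c + (1 - c) * s) * x\<^sup>2, 1 - (c - (1 - c) * s) * x\<^sup>2)))"
proof -
  have c1: "c - 1 \<noteq> 0" using c by simp
  have r0: "r \<noteq> 0" using r c1 by auto
  have s2: "s\<^sup>2 = c / (c - 1)" by (simp add: s r t power_divide)
  have s0: "s \<noteq> 0" and s1: "s\<^sup>2 \<noteq> 1" using s2 c0 c1 by auto
  note n = sqrt_ne_pm1[OF s1]
  define \<alpha> \<beta> where "\<alpha> = c + (1 - c) * s" and "\<beta> = c - (1 - c) * s"
  define S C where "S = fls_const s" and "C = fls_const c"
  define x :: "'a fls" where "x = fls_X"
  define l where "l = r - t"
  have ls: "l = r * (1 - s)" using r0 by (simp add: l_def s right_diff_distrib)
  have \<alpha>: "fls_const \<alpha> = C + (1 - C) * S" and \<beta>: "fls_const \<beta> = C - (1 - C) * S"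
    by (simp_all only: \<alpha>_def \<beta>_def S_def C_def fls.emb_simps fls.emb_1)
  have w: "1 - (C - (1 - C) * S) * x\<^sup>2 \<noteq> 0" "1 - C * x\<^sup>2 \<noteq> 0" "1 - x\<^sup>2 \<noteq> 0" "x \<noteq> 0"
    using one_minus_nonzero[of \<beta>] one_minus_nonzero[of c] one_minus_nonzero[of 1]
    by (simp_all add: \<beta> x_def C_def)
  have yx: "y\<^sup>2 * (1 - C * x\<^sup>2) = 1 - x\<^sup>2" using curve_y by (simp add: C_def x_def)
  define u where "u = fls_const l * (x / y)"
  define v where "v = (1 - (C + (1 - C) * S) * x\<^sup>2) / (1 - (C - (1 - C) * S) * x\<^sup>2)"
  have eq: "u\<^sup>2 + v\<^sup>2 = 1 + fls_const D * u\<^sup>2 * v\<^sup>2"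
    unfolding u_def
  proof (rule iffD2[OF edwards_third_scaling])
    show "(2 :: 'a fls) \<noteq> 0" using two fls.emb_eq_0_iff[of "2::'a"] by (simp only: fls.emb_2) simp
    show "C \<noteq> 0" "C \<noteq> 1" using c0 c by (simp_all add: C_def)
    show "S\<^sup>2 = C / (C - 1)" using arg_cong[OF s2, of fls_const]
      by (simp only: S_def C_def fls.emb_simps fls.emb_1)
    show "fls_const D = ((1 + S) / (1 - S))\<^sup>2" by (simp only: D S_def fls.emb_simps fls.emb_1)
    show "x\<^sup>2 + y\<^sup>2 = 1 + C * x\<^sup>2 * y\<^sup>2" using curve by (simp add: x_def C_def)
    have "l\<^sup>2 = (c - 1) * (1 - s)\<^sup>2" by (simp add: ls power_mult_distrib r)
    from arg_cong[OF this, of fls_const] show "(fls_const l)\<^sup>2 = (C - 1) * (1 - S)\<^sup>2"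
      by (simp only: S_def C_def fls.emb_simps fls.emb_1)
  qed (fact w y_nonzero v_def)+
  \<comment> \<open>By the curve equation 1 / y = y (1 - c x^2) / (1 - x^2), which brings x / y into
    the common shape with a = c and b = 1.\<close>
  have u_alt: "x * y * (fls_const l * (1 - C * x\<^sup>2) / (1 - x\<^sup>2)) = u"
  proof -
    have "x * y * (fls_const l * (1 - C * x\<^sup>2)) * y = fls_const l * x * (y\<^sup>2 * (1 - C * x\<^sup>2))"
      by (simp only: power2_eq_square mult_ac)
    then have "x * y * (fls_const l * (1 - C * x\<^sup>2)) * y = fls_const l * x * (1 - x\<^sup>2)" unfolding yx .
    then show ?thesis using w(3) y_nonzero by (simp add: u_def frac_eq_eq)
  qed
  show ?thesis unfolding \<alpha>_def[symmetric] \<beta>_def[symmetric]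
  proof (rule two_isogeny[where l = l and a = c and b = 1 and \<alpha> = \<alpha> and \<beta> = \<beta>])
    show "D \<noteq> 1" using quotient_square_ne[OF two s0 s1] D by simp
    show "l \<noteq> 0" using n r0 by (simp add: ls)
    have "2 * ((1 - c) * s) \<noteq> 0" using two s0 c by simp
    moreover have "\<alpha> - \<beta> = 2 * ((1 - c) * s)" by (simp add: \<alpha>_def \<beta>_def)
    ultimately show "\<alpha> \<noteq> \<beta>" by auto
    have u': "fls_X * y * (fls_const l * (1 - fls_const c * fls_X\<^sup>2) / (1 - fls_const 1 * fls_X\<^sup>2)) = u"
      and v': "(1 - fls_const \<alpha> * fls_X\<^sup>2) / (1 - fls_const \<beta> * fls_X\<^sup>2) = v"
      using u_alt by (simp_all only: v_def x_def C_def \<alpha> \<beta> fls.emb_1 mult_1)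
    show "(fls_X * y * (fls_const l * (1 - fls_const c * fls_X\<^sup>2) / (1 - fls_const 1 * fls_X\<^sup>2)))\<^sup>2 +
        ((1 - fls_const \<alpha> * fls_X\<^sup>2) / (1 - fls_const \<beta> * fls_X\<^sup>2))\<^sup>2 = 1 + fls_const D *
        (fls_X * y * (fls_const l * (1 - fls_const c * fls_X\<^sup>2) / (1 - fls_const 1 * fls_X\<^sup>2)))\<^sup>2 *
        ((1 - fls_const \<alpha> * fls_X\<^sup>2) / (1 - fls_const \<beta> * fls_X\<^sup>2))\<^sup>2"
      unfolding u' v' by (rule eq)
    fix V and x0 y0 u1 u2 v1 v2 :: 'a
    assume V: "fls.val_ring L V" and xy: "fls.val_at V fls_X x0" "fls.val_at V y y0"
      and h: "(((r - t) * x0, y0), (1 - \<alpha> * x0\<^sup>2, 1 - \<beta> * x0\<^sup>2)) = ((u1, u2), (v1, v2))"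
      and nz: "u2 \<noteq> 0" "v2 \<noteq> 0"
    have "fls.val_at V u (l * (x0 / y0))"
      "fls.val_at V v ((1 - \<alpha> * x0\<^sup>2) / (1 - \<beta> * x0\<^sup>2))"
      unfolding u_def v'[symmetric] x_def using h nz
      by (intro fls.val_at_intros[OF subfield_L V] xy; simp)+
    then show "fls.val_at V (fls_X * y * (fls_const l * (1 - fls_const c * fls_X\<^sup>2) / (1 - fls_const 1 * fls_X\<^sup>2))) (u1 / u2) \<and>
        fls.val_at V ((1 - fls_const \<alpha> * fls_X\<^sup>2) / (1 - fls_const \<beta> * fls_X\<^sup>2)) (v1 / v2)"
      unfolding u' v' using h by (auto simp: l_def)
  qed
qed

end

theorem theorem4p1:
  fixes d :: "'k::field"
    and sqrt_m1 sqrt_d sqrt_1md sqrt_dm1 sqrt_q :: "'k alg_closure"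
    and d0 d1 d2 d3 :: "'k alg_closure"
  assumes char: "CHAR('k) \<noteq> 2"
    and d: "d \<notin> {0, 1}"
    and d0_def: "d0 = to_ac d"
    and sqrt_m1: "sqrt_m1\<^sup>2 = -1"
    and sqrt_d: "sqrt_d\<^sup>2 = d0"
    and sqrt_1md: "sqrt_1md\<^sup>2 = 1 - d0"
    and sqrt_dm1: "sqrt_dm1\<^sup>2 = d0 - 1"
    and sqrt_q: "sqrt_q\<^sup>2 = d0 / (d0 - 1)"
    and sqrt_q_compatible: "sqrt_q = sqrt_d / sqrt_dm1"
    and d1_def: "d1 = ((1 + sqrt_d) / (1 - sqrt_d))\<^sup>2"
    and d2_def: "d2 = ((1 + sqrt_1md) / (1 - sqrt_1md))\<^sup>2"
    and d3_def: "d3 = ((1 + sqrt_q) / (1 - sqrt_q))\<^sup>2"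
  shows "d1 \<notin> {0, 1} \<and> d2 \<notin> {0, 1} \<and> d3 \<notin> {0, 1} \<and>
    (\<exists>\<phi>. edwards_isogeny 2 d0 d1 \<phi> \<and> edwards_given_by d0 d1 \<phi> (\<lambda>x y.
       ((sqrt_m1 * (1 - sqrt_d) / (d0 - 1) * (1 - y\<^sup>2), x * y),
        (1 - sqrt_d * x\<^sup>2, 1 + sqrt_d * x\<^sup>2)))) \<and>
    (\<exists>\<phi>. edwards_isogeny 2 d0 (inverse d1) \<phi> \<and> edwards_given_by d0 (inverse d1) \<phi> (\<lambda>x y.
       ((sqrt_m1 * (1 + sqrt_d) / (d0 - 1) * (1 - y\<^sup>2), x * y),
        (1 + sqrt_d * x\<^sup>2, 1 - sqrt_d * x\<^sup>2)))) \<and>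
    (\<exists>\<phi>. edwards_isogeny 2 d0 d2 \<phi> \<and> edwards_given_by d0 d2 \<phi> (\<lambda>x y.
       (((1 - sqrt_1md) * x * y, 1),
        (1 - (1 - sqrt_1md) * x\<^sup>2, 1 - (1 + sqrt_1md) * x\<^sup>2)))) \<and>
    (\<exists>\<phi>. edwards_isogeny 2 d0 (inverse d2) \<phi> \<and> edwards_given_by d0 (inverse d2) \<phi> (\<lambda>x y.
       (((1 + sqrt_1md) * x * y, 1),
        (1 - (1 + sqrt_1md) * x\<^sup>2, 1 - (1 - sqrt_1md) * x\<^sup>2)))) \<and>
    (\<exists>\<phi>. edwards_isogeny 2 d0 d3 \<phi> \<and> edwards_given_by d0 d3 \<phi> (\<lambda>x y.
       (((sqrt_dm1 - sqrt_d) * x, y),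
        (1 - (d0 + (1 - d0) * sqrt_q) * x\<^sup>2, 1 - (d0 - (1 - d0) * sqrt_q) * x\<^sup>2)))) \<and>
    (\<exists>\<phi>. edwards_isogeny 2 d0 (inverse d3) \<phi> \<and> edwards_given_by d0 (inverse d3) \<phi> (\<lambda>x y.
       (((sqrt_dm1 + sqrt_d) * x, y),
        (1 - (d0 - (1 - d0) * sqrt_q) * x\<^sup>2, 1 - (d0 + (1 - d0) * sqrt_q) * x\<^sup>2))))"
proof -
  have "(2::'k alg_closure) \<noteq> 0"
  proof
    assume "(2::'k alg_closure) = 0"
    then have "of_nat 2 = (0::'k alg_closure)" by simp
    then have "CHAR('k) dvd 2" by (simp only: of_nat_eq_0_iff_char_dvd CHAR_alg_closure)
    then have "CHAR('k) = 1 \<or> CHAR('k) = 2" using dvd_imp_le[of "CHAR('k)" 2] by (cases "CHAR('k)") auto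
    then show False using char CHAR_not_1'[where ?'a = 'k] by auto
  qed
  note two = this
  have d0_ne: "d0 \<noteq> 0" "d0 \<noteq> 1" using d by (auto simp: d0_def)
  \<comment> \<open>All six maps start from the same curve, so one expansion serves them
    all.\<close>
  obtain y where "edwards_series d0 y" using edwards_series_exists[OF two d0_ne(2)] by blast
  then interpret edwards_series d0 y .
  \<comment> \<open>Inverting the parameter amounts to changing the sign of the square root, so the
    lower signs are the upper ones for the opposite root.\<close>
  have inv: "inverse (((1 + s) / (1 - s))\<^sup>2) = ((1 + - s) / (1 - - s))\<^sup>2" for s :: "'k alg_closure"
    by (simp add: power_divide)
  have ne: "((1 + s) / (1 - s))\<^sup>2 \<notin> {0, 1}" if "s \<noteq> 0" "s\<^sup>2 \<noteq> 1" for s :: "'k alg_closure"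
    using quotient_square_ne[OF two that] by simp
  have "d1 \<notin> {0, 1}" unfolding d1_def using sqrt_d d0_ne by (intro ne) auto
  moreover have "d2 \<notin> {0, 1}" unfolding d2_def using sqrt_1md d0_ne by (intro ne) auto
  moreover have "d3 \<notin> {0, 1}" unfolding d3_def using sqrt_q d0_ne by (intro ne) auto
  \<comment> \<open>In the third pair \<open>sqrt_q\<close> and \<open>sqrt_d\<close> change sign
    together while \<open>sqrt_dm1\<close> stays, which preserves s = t / r.\<close>
  ultimately show ?thesis
    using isogeny_sqrt_d[OF sqrt_m1 sqrt_d d0_ne(1) d1_def] isogeny_sqrt_d[of sqrt_m1 "- sqrt_d" "inverse d1"]
      isogeny_sqrt_one_minus_d[OF sqrt_1md d0_ne(1) d2_def] isogeny_sqrt_one_minus_d[of "- sqrt_1md" "inverse d2"]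
      isogeny_sqrt_quotient[OF sqrt_q_compatible sqrt_dm1 sqrt_d d0_ne(1) d3_def]
      isogeny_sqrt_quotient[of "- sqrt_q" "- sqrt_d" sqrt_dm1 "inverse d3"]
      inv sqrt_m1 sqrt_d sqrt_1md sqrt_q_compatible sqrt_dm1 d0_ne(1)
    by (simp add: d1_def d2_def d3_def)
qed

end
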